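(* Let $k$ be a positive integer and let $G$ be a finite simple $2$-connected $k$-regular graph on $n$ vertices. Let $P=uvz$ be a path of $G$ (so $u,v,z$ are distinct, $uv,vz\in E(G)$) such that $\{u,v,z\}$ is not a cut-set of $G$, i.e. $G-\{u,v,z\}$ is connected. If $G$ does not belong to the class $\mathscr{H}$ with respect to $P$ and $n\leqslant 2k+1$, then $G$ has a Hamiltonian cycle containing the path $P$ (i.e. containing both edges $uv$ and $vz$).
   Context: All graphs are finite and simple. Class $\mathscr{H}$: for a $k$-regular graph $G$ and a path $P=uvz$ of $G$, we say that $G$ belongs to $\mathscr{H}$ with respect to $P$ if there is an integer $q\geqslant k$ such that $G$ is a $2$-connected $k$-regular graph on $2q+1$ vertices which contains two disjoint vertex sets $X$ and $Y$ with $Y$ independent, $\{u,v,z\}\subseteq X$, $|Y|=q$, $|X|=q+1$, $N(Y)\subseteq X$ (where $N(Y)$ is the set of vertices adjacent to some vertex of $Y$), and $v$ adjacent to both $u$ and $z$. A Hamiltonian cycle is a cycle containing all vertices of $G$. *)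

theory Defs
  imports Main
begin

definition sgraph :: "'a set \<Rightarrow> ('a \<Rightarrow> 'a \<Rightarrow> bool) \<Rightarrow> bool" where
  "sgraph V E \<longleftrightarrow> finite V \<and> (\<forall>x y. E x y \<longrightarrow> x \<in> V \<and> y \<in> V)
     \<and> (\<forall>x y. E x y \<longrightarrow> E y x) \<and> (\<forall>x. \<not> E x x)"

definition neighbours :: "('a \<Rightarrow> 'a \<Rightarrow> bool) \<Rightarrow> 'a \<Rightarrow> 'a set" where
  "neighbours E x = {y. E x y}"

definition regular :: "'a set \<Rightarrow> ('a \<Rightarrow> 'a \<Rightarrow> bool) \<Rightarrow> nat \<Rightarrow> bool" where
  "regular V E k \<longleftrightarrow> (\<forall>x\<in>V. card (neighbours E x) = k)"

definition connected_on :: "('a \<Rightarrow> 'a \<Rightarrow> bool) \<Rightarrow> 'a set \<Rightarrow> bool" where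
  "connected_on E S \<longleftrightarrow>
     (\<forall>x\<in>S. \<forall>y\<in>S. (\<lambda>a b. a \<in> S \<and> b \<in> S \<and> E a b)\<^sup>*\<^sup>* x y)"

definition two_connected :: "'a set \<Rightarrow> ('a \<Rightarrow> 'a \<Rightarrow> bool) \<Rightarrow> bool" where
  "two_connected V E \<longleftrightarrow> card V \<ge> 3 \<and> connected_on E V
     \<and> (\<forall>x\<in>V. connected_on E (V - {x}))"

definition independent :: "('a \<Rightarrow> 'a \<Rightarrow> bool) \<Rightarrow> 'a set \<Rightarrow> bool" where
  "independent E Y \<longleftrightarrow> (\<forall>x\<in>Y. \<forall>y\<in>Y. \<not> E x y)"

definition nbhd_set :: "('a \<Rightarrow> 'a \<Rightarrow> bool) \<Rightarrow> 'a set \<Rightarrow> 'a set" where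
  "nbhd_set E Y = {x. \<exists>y\<in>Y. E y x}"

definition in_class_H ::
  "'a set \<Rightarrow> ('a \<Rightarrow> 'a \<Rightarrow> bool) \<Rightarrow> nat \<Rightarrow> 'a \<Rightarrow> 'a \<Rightarrow> 'a \<Rightarrow> bool" where
  "in_class_H V E k u v z \<longleftrightarrow>
     (\<exists>q X Y. q \<ge> k \<and> two_connected V E \<and> regular V E k \<and> card V = 2 * q + 1
        \<and> X \<subseteq> V \<and> Y \<subseteq> V \<and> X \<inter> Y = {} \<and> independent E Y
        \<and> {u, v, z} \<subseteq> X \<and> card Y = q \<and> card X = q + 1
        \<and> nbhd_set E Y \<subseteq> X \<and> E v u \<and> E v z)"

definition ham_cycle :: "'a set \<Rightarrow> ('a \<Rightarrow> 'a \<Rightarrow> bool) \<Rightarrow> 'a list \<Rightarrow> bool" where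
  "ham_cycle V E cs \<longleftrightarrow> distinct cs \<and> set cs = V \<and> length cs \<ge> 3
     \<and> (\<forall>i < length cs. E (cs ! i) (cs ! ((i + 1) mod length cs)))"

definition cycle_has_edge :: "'a list \<Rightarrow> 'a \<Rightarrow> 'a \<Rightarrow> bool" where
  "cycle_has_edge cs a b \<longleftrightarrow> (\<exists>i < length cs.
     {cs ! i, cs ! ((i + 1) mod length cs)} = {a, b})"

end

theory Submission
  imports Defs
begin

text \<open>
  Delete \<open>v\<close> and let \<open>Q\<close> be a longest path from \<open>z\<close> to \<open>u\<close> in what remains; the claim is that \<open>Q\<close>
  is spanning. Suppose it is not, and let \<open>D\<close> be a component of the graph off \<open>Q\<close> and \<open>v\<close>, with
  attachment set \<open>T\<close> on \<open>Q\<close>. Two successors on \<open>Q\<close> of vertices of \<open>T\<close> are non-adjacent and have no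
  common neighbour off \<open>Q\<close>, and Ore's crossing argument bounds the sum of their degrees in \<open>G - v\<close>
  by \<open>n - |D|\<close>. These degrees are at least \<open>k - 1\<close>, with equality only for neighbours of \<open>v\<close>, and
  \<open>n \<le> 2k + 1\<close>; hence \<open>|D| \<le> 3\<close>, and if \<open>|D| \<ge> 2\<close> then \<open>v\<close> is adjacent to almost all successors
  and predecessors of \<open>T\<close>. Counting the neighbours of \<open>v\<close> then leaves only \<open>k \<le> 4\<close>, which is excluded
  directly.

  So the vertices off \<open>Q\<close> and \<open>v\<close> are independent. Let \<open>x\<close> be one of them. If \<open>x\<close> is not adjacent to
  \<open>v\<close>, its neighbours alternate along \<open>Q\<close> and the graph is in the exceptional class. Otherwise compare
  \<open>N(x) = T \<union> {v}\<close> with its complement \<open>W\<close>: by regularity the numbers of ordered adjacent pairs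
  inside \<open>W\<close> and inside \<open>N(x)\<close> differ by exactly \<open>k (n - 2k)\<close>. But successors of \<open>T\<close> are independent,
  and so are predecessors, so that \<open>W\<close> contains very few edges, while \<open>N(x)\<close> contains the edges from \<open>v\<close>
  to those of \<open>u, z\<close> that lie in \<open>T\<close>. The few configurations that this count permits are in the
  exceptional class or yield a longer path.
\<close>

section \<open>Paths, successors and predecessors\<close>

text \<open>With \<open>S\<close> off a path and the ends \<open>a\<close>, \<open>b\<close> on it,
  \<open>ds\<close> is exactly the stretch that gets spliced in when the path is rerouted.\<close>

definition linked :: "('a \<Rightarrow> 'a \<Rightarrow> bool) \<Rightarrow> 'a set \<Rightarrow> 'a \<Rightarrow> 'a list \<Rightarrow> 'a \<Rightarrow> bool" where
  "linked E S a ds b \<longleftrightarrow> ds \<noteq> [] \<and> distinct ds \<and> successively E ds \<and> set ds \<subseteq> S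
     \<and> E a (hd ds) \<and> E (last ds) b"

text \<open>A vertex is prepended at each step; if it already occurs, the path is cut back to start
  there, which keeps it simple.\<close>

lemma rtranclp_imp_path:
  assumes "(\<lambda>a b. a \<in> S \<and> b \<in> S \<and> E a b)\<^sup>*\<^sup>* a b" "a \<in> S"
  shows "\<exists>xs. xs \<noteq> [] \<and> hd xs = a \<and> last xs = b \<and> distinct xs \<and> successively E xs \<and> set xs \<subseteq> S"
  using assms
proof (induction rule: converse_rtranclp_induct)
  case base
  then show ?case by (intro exI[of _ "[b]"]) auto
next
  case (step a a')
  then obtain xs where xs: "xs \<noteq> []" "hd xs = a'" "last xs = b" "distinct xs"
      "successively E xs" "set xs \<subseteq> S" by blast
  show ?case
  proof (cases "a \<in> set xs")
    case True
    then obtain ys zs where "xs = ys @ a # zs" by (meson split_list)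
    with xs show ?thesis
      by (intro exI[of _ "a # zs"]) (auto simp: successively_append_iff)
  next
    case False
    with xs step show ?thesis
      by (intro exI[of _ "a # xs"]) (auto simp: successively_Cons)
  qed
qed

lemma two_le_cardE:
  assumes "2 \<le> card A"
  obtains x y where "x \<in> A" "y \<in> A" "x \<noteq> y"
proof -
  obtain B where "B \<subseteq> A" "card B = 2" by (rule obtain_subset_with_card_n[OF assms])
  moreover then obtain x y where "B = {x, y}" "x \<noteq> y" by (meson card_2_iff)
  ultimately show thesis using that[of x y] by simp
qed

lemma card_minus_of_bool: "finite S \<Longrightarrow> card S = card (S - {a}) + of_bool (a \<in> S)"
  by (cases "a \<in> S") (simp_all add: card_Suc_Diff1 del: card_Diff_singleton card_Diff_insert)

lemma card_diff_bound:
  assumes "card (X \<union> Y) \<le> card Y + e" "finite X" "finite Y"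
  shows "card (X - Y) \<le> e"
proof -
  have "card (X \<union> Y) = card (X - Y) + card Y"
    using assms(2,3) by (subst card_Un_disjoint[symmetric]) (auto simp: Un_commute)
  then show ?thesis using assms(1) by simp
qed

definition succs :: "'a list \<Rightarrow> 'a set \<Rightarrow> 'a set" where
  "succs Q T = {Q ! Suc i |i. Suc i < length Q \<and> Q ! i \<in> T}"

definition preds :: "'a list \<Rightarrow> 'a set \<Rightarrow> 'a set" where
  "preds Q T = {Q ! i |i. Suc i < length Q \<and> Q ! Suc i \<in> T}"

text \<open>Reversal turns each result on successors into one on predecessors, with \<open>u\<close>
  and \<open>z\<close> exchanged.\<close>

lemma succs_rev: "succs (rev Q) T = preds Q T"
proof -
  have "succs (rev Q) T \<subseteq> preds Q T" for Q :: "'a list"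
  proof
    fix y assume "y \<in> succs (rev Q) T"
    then obtain i where i: "y = rev Q ! Suc i" "Suc i < length Q" "rev Q ! i \<in> T"
      by (auto simp: succs_def)
    then have "y = Q ! (length Q - Suc (Suc i))" "Q ! Suc (length Q - Suc (Suc i)) \<in> T"
      by (auto simp: rev_nth Suc_diff_Suc)
    with i show "y \<in> preds Q T" unfolding preds_def by force
  qed
  moreover have "preds Q T \<subseteq> succs (rev Q) T" for Q :: "'a list"
  proof
    fix y assume "y \<in> preds Q T"
    then obtain i where i: "y = Q ! i" "Suc i < length Q" "Q ! Suc i \<in> T"
      by (auto simp: preds_def)
    then have "y = rev Q ! Suc (length Q - Suc (Suc i))" "rev Q ! (length Q - Suc (Suc i)) \<in> T"
      by (auto simp: rev_nth Suc_diff_Suc)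
    with i show "y \<in> succs (rev Q) T" unfolding succs_def by force
  qed
  ultimately show ?thesis by blast
qed

lemma preds_rev: "preds (rev Q) T = succs Q T"
  by (metis rev_rev_ident succs_rev)

lemma succs_subset: "succs Q T \<subseteq> set Q" by (auto simp: succs_def)

lemma preds_subset: "preds Q T \<subseteq> set Q" by (auto simp: preds_def)

lemma finite_succs [simp]: "finite (succs Q S)" by (rule finite_subset[OF succs_subset]) simp

lemma finite_preds [simp]: "finite (preds Q S)" by (rule finite_subset[OF preds_subset]) simp

lemma succs_mono: "S \<subseteq> T \<Longrightarrow> succs Q S \<subseteq> succs Q T" by (auto simp: succs_def)

lemma preds_mono: "S \<subseteq> S' \<Longrightarrow> preds Q S \<subseteq> preds Q S'" by (auto simp: preds_def)

lemma card_succs: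
  assumes "distinct Q" "T \<subseteq> set Q" "Q \<noteq> []"
  shows "card (succs Q T) = card (T - {last Q})"
proof -
  let ?I = "{i. Suc i < length Q \<and> Q ! i \<in> T}"
  have 1: "succs Q T = (\<lambda>i. Q ! Suc i) ` ?I" by (auto simp: succs_def)
  have 2: "T - {last Q} = (\<lambda>i. Q ! i) ` ?I"
  proof (intro equalityI subsetI)
    fix t assume t: "t \<in> T - {last Q}"
    then obtain i where i: "i < length Q" "Q ! i = t" using assms(2) by (metis DiffD1 in_set_conv_nth subsetD)
    with t have "Suc i < length Q"
      by (metis DiffE Suc_lessI assms(3) diff_Suc_1 insertI1 last_conv_nth)
    with i t show "t \<in> (\<lambda>i. Q ! i) ` ?I" by auto
  qed (use assms in \<open>auto simp: last_conv_nth nth_eq_iff_index_eq\<close>)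
  have "inj_on (\<lambda>i. Q ! Suc i) ?I" "inj_on (\<lambda>i. Q ! i) ?I"
    using assms(1) by (auto intro!: inj_onI simp: nth_eq_iff_index_eq)
  then show ?thesis unfolding 1 2 by (simp add: card_image)
qed

lemma hd_notin_succs: "distinct Q \<Longrightarrow> hd Q \<notin> succs Q T"
  by (cases Q) (auto simp: succs_def in_set_conv_nth)

text \<open>The positions form a half-open interval, \<open>b\<close> excluded, so that neighbouring
  segments concatenate.\<close>

definition seg :: "'a list \<Rightarrow> nat \<Rightarrow> nat \<Rightarrow> 'a list" where
  "seg Q a b = drop a (take b Q)"

lemma seg_simps:
  assumes "a < b" "b \<le> length Q"
  shows "seg Q a b \<noteq> []" "hd (seg Q a b) = Q ! a" "last (seg Q a b) = Q ! (b - 1)"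
    "length (seg Q a b) = b - a"
  using assms by (auto simp: seg_def hd_drop_conv_nth last_conv_nth)

lemma seg_join: "a \<le> b \<Longrightarrow> b \<le> c \<Longrightarrow> c \<le> length Q \<Longrightarrow> seg Q a b @ seg Q b c = seg Q a c"
proof -
  assume "a \<le> b" "b \<le> c" "c \<le> length Q"
  then have "drop a (take c Q) = drop a (take b Q @ drop b (take c Q))"
    using append_take_drop_id[of b "take c Q"] by (simp add: min_def)
  then show ?thesis using \<open>a \<le> b\<close> \<open>b \<le> c\<close> \<open>c \<le> length Q\<close> by (simp add: seg_def)
qed

lemma seg_all: "seg Q 0 (length Q) = Q" by (simp add: seg_def)

lemma seg_two: "Suc a < length Q \<Longrightarrow> seg Q a (Suc (Suc a)) = [Q ! a, Q ! Suc a]"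
  by (simp add: seg_def take_Suc_conv_app_nth)

section \<open>A longest path and its rotations\<close>

locale graph =
  fixes V :: "'a set" and E :: "'a \<Rightarrow> 'a \<Rightarrow> bool" and k :: nat
  assumes sg: "sgraph V E" and reg: "regular V E k"
begin

lemma finV: "finite V" and inV: "E x y \<Longrightarrow> x \<in> V" "E x y \<Longrightarrow> y \<in> V"
  and sym: "E x y \<Longrightarrow> E y x" and irr: "\<not> E x x"
  using sg by (auto simp: sgraph_def)

abbreviation N :: "'a \<Rightarrow> 'a set" where "N x \<equiv> {y. E x y}"

lemma finN: "finite (N x)" by (rule finite_subset[OF _ finV]) (auto dest: inV)

lemma cardN: "x \<in> V \<Longrightarrow> card (N x) = k"
  using reg by (auto simp: regular_def neighbours_def)

lemma E_comm: "E x y \<longleftrightarrow> E y x" using sym by blast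

lemma successively_flip [simp]: "successively (\<lambda>x y. E y x) xs \<longleftrightarrow> successively E xs"
proof -
  have "(\<lambda>x y. E y x) = E" by (intro ext) (rule E_comm)
  then show ?thesis by (rule arg_cong)
qed
end

text \<open>If \<open>Q\<close> is spanning in the graph without \<open>v\<close>, the edges
  \<open>uv\<close> and \<open>vz\<close> close it to the cycle sought.\<close>

locale longest_path = graph V E k for V :: "'a set" and E k +
  fixes v z u :: 'a and Q :: "'a list"
  assumes two: "two_connected V E" and conn3: "connected_on E (V - {u, v, z})"
    and small: "card V \<le> 2 * k + 1"
    and zu: "z \<noteq> u" and vz: "E v z" and vu: "E v u"
    and distQ: "distinct Q" and succQ: "successively E Q" and subQ: "set Q \<subseteq> V - {v}"
    and neQ: "Q \<noteq> []" and hdQ: "hd Q = z" and lastQ: "last Q = u"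
    and maxQ: "\<And>P. \<lbrakk>distinct P; successively E P; set P \<subseteq> V - {v}; P \<noteq> []; hd P = z; last P = u\<rbrakk>
       \<Longrightarrow> length P \<le> length Q"
begin

abbreviation "R \<equiv> V - {v} - set Q"

lemma reversed: "longest_path V E k v u z (rev Q)"
proof
  show "two_connected V E" by (rule two)
  show "connected_on E (V - {z, v, u})" using conn3 by (simp add: insert_commute)
  show "length P \<le> length (rev Q)" if "distinct P" "successively E P" "set P \<subseteq> V - {v}" "P \<noteq> []"
    "hd P = u" "last P = z" for P
    using maxQ[of "rev P"] that by (simp add:  hd_rev last_rev)
qed (use small zu vz vu distQ succQ subQ neQ hdQ lastQ in \<open>auto simp:  hd_rev last_rev\<close>)

section \<open>Reroutings of the path\<close>

lemma gap_lists:
  assumes "Q = A @ B @ C" "A \<noteq> []" "C \<noteq> []" "linked E R (last A) ds (hd C)"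
  shows "length ds \<le> length B"
proof -
  have "length (A @ ds @ C) \<le> length Q"
    by (rule maxQ) (use assms distQ succQ subQ hdQ lastQ in
      \<open>auto simp: linked_def successively_append_iff\<close>)
  then show ?thesis using assms by simp
qed

text \<open>After the detour \<open>ds\<close>, \<open>B\<close> is traversed backwards, and
  \<open>hd B\<close> has to be joined to \<open>hd C\<close>. An edge, or a second disjoint detour
  \<open>es\<close>, would complete a path longer than \<open>Q\<close>.\<close>

lemma cross_lists:
  assumes "Q = A @ B @ C" "A \<noteq> []" "B \<noteq> []" "C \<noteq> []" "linked E R (last A) ds (last B)"
  shows "\<not> E (hd B) (hd C)"
    and "set es \<inter> set ds = {} \<Longrightarrow> \<not> linked E R (hd B) es (hd C)"
proof -
  show "\<not> E (hd B) (hd C)"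
  proof
    assume "E (hd B) (hd C)"
    then have "length (A @ ds @ rev B @ C) \<le> length Q"
      by (intro maxQ) (use assms distQ succQ subQ hdQ lastQ in
        \<open>auto simp: linked_def successively_append_iff  hd_rev last_rev\<close>)
    then show False using assms by (simp add: linked_def)
  qed
  show "\<not> linked E R (hd B) es (hd C)" if "set es \<inter> set ds = {}"
  proof
    assume "linked E R (hd B) es (hd C)"
    then have "length (A @ ds @ rev B @ es @ C) \<le> length Q"
      by (intro maxQ) (use that assms distQ succQ subQ hdQ lastQ in
        \<open>auto simp: linked_def successively_append_iff  hd_rev last_rev\<close>)
    then show False using assms by (simp add: linked_def)
  qed
qed

text \<open>The path \<open>A\<close>, \<open>B\<close>, reversed \<open>ds\<close>, reversed
  \<open>A'\<close>, \<open>C\<close> visits all of \<open>Q\<close> and also \<open>ds\<close>.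
  This lemma and the two after it treat chords that end before, between and after the two ends of
  the detour.\<close>

lemma crossA_lists:
  assumes "Q = A @ A' @ B @ C" "A \<noteq> []" "A' \<noteq> []" "B \<noteq> []" "C \<noteq> []"
    "linked E R (last A') ds (last B)" "E (hd B) (last A)" "E (hd C) (hd A')"
  shows False
proof -
  have "length (A @ B @ rev ds @ rev A' @ C) \<le> length Q"
    using sym[OF assms(7)] sym[OF assms(8)]
    by (intro maxQ) (use assms distQ succQ subQ hdQ lastQ in
      \<open>auto simp: linked_def successively_append_iff  hd_rev last_rev dest: sym\<close>)
  then show False using assms by (simp add: linked_def)
qed

lemma crossB_lists:
  assumes "Q = A @ B @ B' @ C" "A \<noteq> []" "B \<noteq> []" "B' \<noteq> []" "C \<noteq> []"
    "linked E R (last A) ds (last B')" "E (hd B) (hd B')" "E (hd C) (last B)"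
  shows False
proof -
  have "length (A @ ds @ rev B' @ B @ C) \<le> length Q"
    using sym[OF assms(7)] sym[OF assms(8)]
    by (intro maxQ) (use assms distQ succQ subQ hdQ lastQ in
      \<open>auto simp: linked_def successively_append_iff  hd_rev last_rev dest: sym\<close>)
  then show False using assms by (simp add: linked_def)
qed

lemma crossC_lists:
  assumes "Q = A @ B @ C @ C'" "A \<noteq> []" "B \<noteq> []" "C \<noteq> []" "C' \<noteq> []"
    "linked E R (last A) ds (last B)" "E (hd B) (last C)" "E (hd C) (hd C')"
  shows False
proof -
  have "length (A @ ds @ rev B @ rev C @ C') \<le> length Q"
    by (intro maxQ) (use assms distQ succQ subQ hdQ lastQ in
      \<open>auto simp: linked_def successively_append_iff  hd_rev last_rev dest: sym\<close>)
  then show False using assms by (simp add: linked_def)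
qed

lemma Q_split:
  assumes "a \<le> b" "b \<le> length Q"
  shows "Q = seg Q 0 a @ seg Q a b @ seg Q b (length Q)"
  using assms by (simp add: seg_join seg_all)

lemma Q_split4:
  assumes "a \<le> b" "b \<le> c" "c \<le> length Q"
  shows "Q = seg Q 0 a @ seg Q a b @ seg Q b c @ seg Q c (length Q)"
  using assms by (simp add: seg_join seg_all)

lemma gap:
  assumes "i < j" "j < length Q" "linked E R (Q ! i) ds (Q ! j)"
  shows "length ds < j - i"
proof -
  have "length ds \<le> length (seg Q (Suc i) j)"
  proof (rule gap_lists[OF Q_split])
    show "linked E R (last (seg Q 0 (Suc i))) ds (hd (seg Q j (length Q)))"
      using assms by (simp add: seg_simps)
  qed (use assms seg_simps[of _ _ Q] in auto)
  then show ?thesis using assms by (simp add: seg_def)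
qed

lemma cross:
  assumes "i < j" "Suc j < length Q" "linked E R (Q ! i) ds (Q ! j)"
  shows "\<not> E (Q ! Suc i) (Q ! Suc j)"
    and "set es \<inter> set ds = {} \<Longrightarrow> \<not> linked E R (Q ! Suc i) es (Q ! Suc j)"
  using cross_lists(1)[OF Q_split[of "Suc i" "Suc j"], of ds]
    cross_lists(2)[OF Q_split[of "Suc i" "Suc j"], of ds es] assms by (simp_all add: seg_simps)

lemma crossA:
  assumes "i < j" "Suc j < length Q" "linked E R (Q ! i) ds (Q ! j)" "l < i"
    "E (Q ! Suc i) (Q ! l)"
  shows "\<not> E (Q ! Suc j) (Q ! Suc l)"
  using crossA_lists[OF Q_split4[of "Suc l" "Suc i" "Suc j"], of ds] assms
  by (auto simp add: seg_simps)

lemma crossB: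
  assumes "i < j" "Suc j < length Q" "linked E R (Q ! i) ds (Q ! j)" "i < l" "l < j"
    "E (Q ! Suc i) (Q ! Suc l)"
  shows "\<not> E (Q ! Suc j) (Q ! l)"
  using crossB_lists[OF Q_split4[of "Suc i" "Suc l" "Suc j"], of ds] assms
  by (auto simp add: seg_simps)

lemma crossC:
  assumes "i < j" "linked E R (Q ! i) ds (Q ! j)" "j < l" "Suc l < length Q"
    "E (Q ! Suc i) (Q ! l)"
  shows "\<not> E (Q ! Suc j) (Q ! Suc l)"
  using crossC_lists[OF Q_split4[of "Suc i" "Suc j" "Suc l"], of ds] assms
  by (auto simp add: seg_simps)

lemma nbrs_on_Q:
  assumes "y \<in> V"
  shows "card (N y \<inter> set Q) = card {l. l < length Q \<and> E y (Q ! l)}"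
proof -
  have "N y \<inter> set Q = (!) Q ` {l. l < length Q \<and> E y (Q ! l)}"
    by (auto simp: in_set_conv_nth)
  moreover have "inj_on ((!) Q) {l. l < length Q \<and> E y (Q ! l)}"
    using distQ by (auto intro!: inj_onI simp: nth_eq_iff_index_eq)
  ultimately show ?thesis by (simp add: card_image)
qed

lemma nthQ_V: "i < length Q \<Longrightarrow> Q ! i \<in> V" using subQ nth_mem by blast

lemma pair_sum_on_path:
  assumes ij: "i < j" "Suc j < length Q" and lk: "linked E R (Q ! i) ds (Q ! j)"
  shows "card (N (Q ! Suc i) \<inter> set Q) + card (N (Q ! Suc j) \<inter> set Q) \<le> length Q + 1"
proof -
  define I where "I = {l. l < length Q \<and> E (Q ! Suc i) (Q ! l)}"
  define J where "J = {l. l < length Q \<and> E (Q ! Suc j) (Q ! l)}"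
  \<comment> \<open>The three crossing lemmas say that \<open>g\<close> maps neighbours of one successor to non-neighbours of the other;
    \<open>i\<close> is sent to the index of the other successor itself.\<close>
  define g where "g l = (if l < i then Suc l else if l = i then Suc j else if l \<le> j then l - 1 else Suc l)" for l
  have I: "Suc i \<notin> I" "Suc j \<notin> I" using irr cross(1)[OF ij lk] by (auto simp: I_def)
  have J: "Suc j \<notin> J" using irr by (auto simp: J_def)
  \<comment> \<open>For \<open>i > 0\<close>, \<open>g\<close> takes the value \<open>i\<close> both
    at \<open>i - 1\<close> and at \<open>Suc i\<close>; this is harmless because
    \<open>Suc i\<close> is not in \<open>I\<close>.\<close>
  have inj: "inj_on g I"
  proof (rule inj_onI)
    fix a b assume "a \<in> I" "b \<in> I" "g a = g b"
    moreover from this I have "a \<noteq> Suc i" "b \<noteq> Suc i" by metis+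
    ultimately show "a = b" using ij(1) by (auto simp: g_def split: if_splits)
  qed
  have "g l \<notin> J" if l: "l \<in> I" for l
  proof -
    have l': "l < length Q" "E (Q ! Suc i) (Q ! l)" using l by (auto simp: I_def)
    consider "l < i" | "l = i" | "i < l" "l \<le> j" | "j < l" by linarith
    then show ?thesis
    proof cases
      case 1
      then show ?thesis using crossA[OF ij lk] l' by (auto simp: g_def J_def)
    next
      case 2
      then show ?thesis using J by (simp add: g_def)
    next
      case 3
      with I l have "l \<noteq> Suc i" by metis
      then obtain l0 where "l = Suc l0" "i < l0" "l0 < j" using 3 by (cases l) auto
      then show ?thesis using crossB[OF ij lk] l' by (auto simp: g_def J_def)
    next
      case 4
      then show ?thesis using crossC[OF ij(1) lk, of l] l' ij by (auto simp: g_def J_def)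
    qed
  qed
  then have "g ` I \<inter> J = {}" by auto
  \<comment> \<open>The last position may be sent to \<open>length Q\<close>, just off the path;
    hence the \<open>+ 1\<close> in the bound.\<close>
  moreover have "g ` I \<subseteq> {..length Q}" "J \<subseteq> {..length Q}"
    using ij by (auto simp: g_def I_def J_def)
  ultimately have "card (g ` I) + card J \<le> card {..length Q}"
    by (metis Un_least card_Un_disjoint card_mono finite_atMost finite_subset)
  then have "card I + card J \<le> length Q + 1" by (simp add: card_image[OF inj])
  then show ?thesis unfolding I_def J_def using ij by (simp add: nbrs_on_Q nthQ_V)
qed

end

section \<open>Components off the path\<close>

lemma connected_on_leaving_edge:
  assumes "connected_on E S" "D \<subseteq> S" "x \<in> D" "y \<in> S - D"
  obtains a b where "a \<in> D" "b \<in> S - D" "E a b"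
proof -
  have "(\<lambda>a b. a \<in> S \<and> b \<in> S \<and> E a b)\<^sup>*\<^sup>* x y"
    using assms unfolding connected_on_def by blast
  then have "y \<in> D \<or> (\<exists>a\<in>D. \<exists>b\<in>S - D. E a b)"
    using \<open>x \<in> D\<close> by (induction rule: rtranclp_induct) auto
  then show thesis using that assms(4) by blast
qed

lemma linked_mono: "linked E S a ds b \<Longrightarrow> S \<subseteq> S' \<Longrightarrow> linked E S' a ds b"
  by (auto simp: linked_def)

lemma (in longest_path) card_R: "card R + length Q + 1 = card V"
proof -
  have "card (V - {v}) = card V - 1" "card V > 0" using inV(1)[OF vz] finV
    by (auto simp: card_gt_0_iff)
  moreover have "card R = card (V - {v}) - card (set Q)"
    using subQ finV by (intro card_Diff_subset) auto
  moreover have "card (set Q) \<le> card (V - {v})" using subQ finV by (intro card_mono) auto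
  ultimately show ?thesis using distQ by (simp add: distinct_card)
qed

lemma (in longest_path) uz_Q: "z \<in> set Q" "u \<in> set Q"
  using hdQ lastQ neQ by auto

lemma (in longest_path) v_notin_Q: "v \<notin> set Q" using subQ by auto

lemma (in longest_path) length_Q_ge_2: "length Q \<ge> 2"
  using hdQ lastQ zu neQ by (cases Q rule: list.exhaust; cases "tl Q") auto

lemma (in longest_path) nth_Q_eq_iff:
  "\<lbrakk>i < length Q; j < length Q\<rbrakk> \<Longrightarrow> Q ! i = Q ! j \<longleftrightarrow> i = j"
  using distQ by (simp add: nth_eq_iff_index_eq)

lemma (in longest_path) E_nth: "Suc i < length Q \<Longrightarrow> E (Q ! i) (Q ! Suc i)"
  using succQ by (simp add: successively_conv_nth)

section \<open>A component and its attachments to the path\<close>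

locale longest_path_comp = longest_path V E k v z u Q
  for V :: "'a set" and E k v z u Q +
  fixes D :: "'a set"
  assumes D_sub: "D \<subseteq> V - {v} - set Q" and D_ne: "D \<noteq> {}"
    and D_conn: "\<lbrakk>a \<in> D; b \<in> D\<rbrakk> \<Longrightarrow> \<exists>ds. ds \<noteq> [] \<and> hd ds = a \<and> last ds = b \<and> distinct ds
        \<and> successively E ds \<and> set ds \<subseteq> D"
    and D_nbr: "\<lbrakk>x \<in> D; E x y\<rbrakk> \<Longrightarrow> y \<in> D \<union> set Q \<union> {v}"
begin

lemma comp_reversed: "longest_path_comp V E k v u z (rev Q) D"
  using reversed D_sub D_ne D_conn D_nbr
  unfolding longest_path_comp_def longest_path_comp_axioms_def by simp

definition T :: "'a set" where "T = {p \<in> set Q. \<exists>x\<in>D. E x p}"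

lemma T_sub: "T \<subseteq> set Q" by (auto simp: T_def)

lemma finT: "finite T" using T_sub finite_subset by blast

lemma finD: "finite D" using D_sub finV finite_subset by blast

lemma obtain_link:
  assumes "x \<in> D" "y \<in> D" "E x p" "E y q"
  obtains ds where "linked E D p ds q" "linked E R p ds q" "x \<noteq> y \<Longrightarrow> length ds \<ge> 2"
proof -
  obtain ds where ds: "ds \<noteq> []" "hd ds = x" "last ds = y" "distinct ds" "successively E ds" "set ds \<subseteq> D"
    using D_conn assms by blast
  then have lk: "linked E D p ds q" using assms sym by (auto simp: linked_def)
  moreover have "length ds \<ge> 2" if "x \<noteq> y"
    using ds that by (cases ds rule: list.exhaust; cases "tl ds") auto
  ultimately show thesis using that linked_mono[OF lk D_sub] by blast
qed

text \<open>A detour with at least two inner vertices would replace a single vertex of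
  \<open>Q\<close>.\<close>

lemma gap2:
  assumes "x \<in> D" "y \<in> D" "x \<noteq> y" "E x (Q ! i)" "E y (Q ! Suc (Suc i))" "Suc (Suc i) < length Q"
  shows False
proof -
  obtain ds where "linked E R (Q ! i) ds (Q ! Suc (Suc i))" "length ds \<ge> 2"
    using obtain_link assms by metis
  then show False using gap[of i "Suc (Suc i)" ds] assms by simp
qed

lemma no_consec:
  assumes "Suc i < length Q" "Q ! i \<in> T" shows "Q ! Suc i \<notin> T"
proof
  assume "Q ! Suc i \<in> T"
  then obtain x y where "x \<in> D" "y \<in> D" "E x (Q ! i)" "E y (Q ! Suc i)" using assms by (auto simp: T_def)
  then obtain ds where "linked E R (Q ! i) ds (Q ! Suc i)"
    using obtain_link by metis
  then show False using gap[of i "Suc i" ds] assms by (simp add: linked_def)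
qed

lemma succs_disj: "T \<inter> succs Q T = {}"
  using no_consec by (auto simp: succs_def)

lemma succs_no_D: "y \<in> succs Q T \<Longrightarrow> x \<in> D \<Longrightarrow> \<not> E x y"
  using succs_disj succs_subset[of Q T] by (auto simp: T_def)

text \<open>The two successors may occur along \<open>Q\<close> in either order, while the
  reroutings need \<open>i < j\<close>; the unordered pair absorbs the swap.\<close>

lemma succs_pair:
  assumes "y \<in> succs Q T" "y' \<in> succs Q T" "y \<noteq> y'"
  obtains i j ds a b where "i < j" "Suc j < length Q" "linked E D (Q ! i) ds (Q ! j)"
    "linked E R (Q ! i) ds (Q ! j)" "{y, y'} = {a, b}" "a = Q ! Suc i" "b = Q ! Suc j"
proof -
  obtain i j where ij: "y = Q ! Suc i" "Suc i < length Q" "Q ! i \<in> T"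
    "y' = Q ! Suc j" "Suc j < length Q" "Q ! j \<in> T" using assms by (auto simp: succs_def)
  then obtain x x' where x: "x \<in> D" "E x (Q ! i)" "x' \<in> D" "E x' (Q ! j)" by (auto simp: T_def)
  obtain ds where ds: "linked E D (Q ! i) ds (Q ! j)" "linked E R (Q ! i) ds (Q ! j)"
    using obtain_link x by metis
  obtain es where es: "linked E D (Q ! j) es (Q ! i)" "linked E R (Q ! j) es (Q ! i)"
    using obtain_link x by metis
  have "i \<noteq> j" using assms ij by auto
  then consider "i < j" | "j < i" by linarith
  then show thesis
    by cases (use that[of i j ds y y'] that[of j i es y' y] ds es ij in auto)
qed

lemma succs_indep: "y \<in> succs Q T \<Longrightarrow> y' \<in> succs Q T \<Longrightarrow> \<not> E y y'"
  by (metis (no_types, lifting) cross(1) doubleton_eq_iff irr succs_pair sym)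

text \<open>The connection \<open>ds\<close> runs inside \<open>D\<close>, so it is disjoint from
  the one-vertex connection \<open>w\<close>, and both could be inserted at once.\<close>

lemma succs_no_common:
  assumes "y \<in> succs Q T" "y' \<in> succs Q T" "y \<noteq> y'" "w \<in> R - D" "E y w" "E y' w"
  shows False
proof -
  obtain i j ds a b where *: "i < j" "Suc j < length Q" "linked E D (Q ! i) ds (Q ! j)"
    "linked E R (Q ! i) ds (Q ! j)" "{y, y'} = {a, b}" "a = Q ! Suc i" "b = Q ! Suc j"
    using succs_pair assms(1-3) by metis
  have "E a w" "E w b" using * assms(5,6) sym by (auto simp: doubleton_eq_iff)
  then have "linked E R (Q ! Suc i) [w] (Q ! Suc j)" using * assms(4) by (auto simp: linked_def)
  moreover have "set [w] \<inter> set ds = {}" using * assms(4) by (auto simp: linked_def)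
  ultimately show False using cross(2) * by blast
qed

lemma nbr_partition:
  assumes "y \<in> V"
  shows "k = card (N y \<inter> set Q) + card (N y \<inter> D) + card (N y \<inter> (R - D)) + of_bool (E v y)"
proof -
  have "N y = (N y \<inter> set Q) \<union> (N y \<inter> D) \<union> (N y \<inter> (R - D)) \<union> (N y \<inter> {v})"
    using D_sub subQ inV by auto
  also have "card \<dots> = card (N y \<inter> set Q \<union> (N y \<inter> D) \<union> (N y \<inter> (R - D))) + card (N y \<inter> {v})"
    using finN D_sub v_notin_Q by (intro card_Un_disjoint) auto
  also have "card (N y \<inter> set Q \<union> (N y \<inter> D) \<union> (N y \<inter> (R - D)))
      = card (N y \<inter> set Q \<union> (N y \<inter> D)) + card (N y \<inter> (R - D))"
    using finN D_sub by (intro card_Un_disjoint) auto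
  also have "card (N y \<inter> set Q \<union> (N y \<inter> D)) = card (N y \<inter> set Q) + card (N y \<inter> D)"
    using finN D_sub by (intro card_Un_disjoint) auto
  also have "card (N y \<inter> {v}) = of_bool (E v y)" by (auto simp: E_comm[of v y])
  finally show ?thesis using assms by (simp add: cardN)
qed

lemma card_RD: "card (R - D) + card D + length Q + 1 = card V"
  using card_R card_Diff_subset[OF finD D_sub] card_mono[OF _ D_sub] finV by simp

text \<open>Neighbours on \<open>Q\<close> are bounded by \<open>pair_sum_on_path\<close>, there are
  none in \<open>D\<close>, and those in the rest of \<open>R\<close> are not shared; adjacency to
  \<open>v\<close> accounts for the two indicators.\<close>

lemma succs_degree_sum:
  assumes "y \<in> succs Q T" "y' \<in> succs Q T" "y \<noteq> y'"
  shows "2 * k + card D \<le> card V + of_bool (E v y) + of_bool (E v y')"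
proof -
  have yV: "y \<in> V" "y' \<in> V" using assms succs_subset[of Q T] subQ by auto
  obtain i j ds a b where *: "i < j" "Suc j < length Q"
    "linked E R (Q ! i) ds (Q ! j)" "{y, y'} = {a, b}" "a = Q ! Suc i" "b = Q ! Suc j"
    using succs_pair assms(1-3) by metis
  have "card (N y \<inter> set Q) + card (N y' \<inter> set Q) \<le> length Q + 1"
    using pair_sum_on_path[OF *(1-3)] *(4-6) by (auto simp: doubleton_eq_iff)
  moreover have "N y \<inter> D = {}" "N y' \<inter> D = {}" using succs_no_D assms sym by blast+
  moreover have "card (N y \<inter> (R - D)) + card (N y' \<inter> (R - D)) \<le> card (R - D)"
  proof -
    have "card (N y \<inter> (R - D)) + card (N y' \<inter> (R - D)) = card (N y \<inter> (R - D) \<union> (N y' \<inter> (R - D)))"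
      using succs_no_common[OF assms] finN by (intro card_Un_disjoint[symmetric]) auto
    also have "\<dots> \<le> card (R - D)" using finV by (intro card_mono) auto
    finally show ?thesis .
  qed
  ultimately show ?thesis
    using nbr_partition[OF yV(1)] nbr_partition[OF yV(2)] card_RD by auto
qed

lemma vV: "v \<in> V" using inV vz by blast

lemma T_ne: "T \<noteq> {}"
proof -
  obtain x where x: "x \<in> D" using D_ne by blast
  have "connected_on E (V - {v})" using two vV by (auto simp: two_connected_def)
  moreover have "D \<subseteq> V - {v}" "z \<in> V - {v} - D" using D_sub uz_Q subQ by auto
  ultimately obtain a b where "a \<in> D" "b \<in> V - {v} - D" "E a b"
    using connected_on_leaving_edge x by metis
  then show ?thesis using D_nbr[of a b] by (auto simp: T_def)
qed

lemma k_ge_3: "k \<ge> 3"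
proof -
  obtain i x where i: "i < length Q" "x \<in> D" "E x (Q ! i)"
    using T_ne by (auto simp: T_def in_set_conv_nth)
  \<comment> \<open>At an end of \<open>Q\<close> the missing neighbour on the path is replaced by
    \<open>v\<close>, which is adjacent to both \<open>z\<close> and \<open>u\<close>.\<close>
  define a where "a = (if i = 0 then v else Q ! (i - 1))"
  define b where "b = (if Suc i = length Q then v else Q ! Suc i)"
  have z0: "Q ! 0 = z" "Q ! (length Q - 1) = u" using hdQ lastQ neQ by (auto simp: hd_conv_nth last_conv_nth)
  have "E (Q ! i) a"
    using z0 vz sym E_nth[of "i - 1"] i by (auto simp: a_def)
  moreover have "E (Q ! i) b"
  proof (cases "Suc i = length Q")
    case True
    then have "Q ! i = u" using z0 by (metis diff_Suc_1)
    then show ?thesis using vu sym True by (simp add: b_def)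
  qed (use E_nth[of i] i in \<open>simp add: b_def\<close>)
  moreover have "a \<noteq> b"
    using length_Q_ge_2 i v_notin_Q distQ nth_mem[of "i-1" Q] nth_mem[of "Suc i" Q]
    by (auto simp: a_def b_def nth_eq_iff_index_eq)
  moreover have "x \<noteq> a" "x \<noteq> b" using i D_sub nth_mem[of "i-1" Q] nth_mem[of "Suc i" Q]
    by (auto simp: a_def b_def)
  ultimately have "card {x, a, b} \<le> card (N (Q ! i))"
    using finN i by (intro card_mono) (auto intro: sym)
  then show ?thesis using \<open>a \<noteq> b\<close> \<open>x \<noteq> a\<close> \<open>x \<noteq> b\<close> cardN[OF nthQ_V[OF i(1)]] by simp
qed

text \<open>With a single attachment \<open>p\<close>, the pair \<open>p, v\<close> separates the graph into parts of at least \<open>k - 1\<close>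
  vertices each, and there are not enough edges between them and the pair.\<close>

lemma card_T_ne_1: "card T \<noteq> 1"
proof
  assume "card T = 1"
  then obtain p where p: "T = {p}" by (auto simp: card_1_singleton_iff)
  define W where "W = V - D - {p, v}"
  have pQ: "p \<in> set Q" "p \<in> V" "p \<notin> D" "p \<noteq> v" using p T_sub subQ D_sub by auto
  have vD: "v \<notin> D" using D_sub by auto
  have D_N: "N x \<subseteq> D - {x} \<union> {p, v}" if "x \<in> D" for x
    using D_nbr[OF that] p that irr by (auto simp: T_def)
  have W_N: "N x \<subseteq> W - {x} \<union> {p, v}" if "x \<in> W" for x
    using D_N that irr inV sym unfolding W_def by blast
  have finW: "finite W" using finV by (simp add: W_def)
  have cW: "card W + card D + 2 = card V"
  proof -
    have "V = W \<union> D \<union> {p, v}" using pQ vV D_sub by (auto simp: W_def)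
    also have "card \<dots> = card (W \<union> D) + card {p, v}"
      using finW finD pQ vD by (intro card_Un_disjoint) (auto simp: W_def)
    also have "card (W \<union> D) = card W + card D"
      using finW finD by (intro card_Un_disjoint) (auto simp: W_def)
    finally show ?thesis using pQ by simp
  qed
  have uzW: "\<exists>w. w \<in> {u, z} \<inter> W"
    using zu uz_Q subQ D_sub pQ by (auto simp: W_def)
  obtain x0 where x0: "x0 \<in> D" "E v x0"
  proof -
    obtain x where x: "x \<in> D" using D_ne by blast
    obtain w where w: "w \<in> W" using uzW by blast
    have "connected_on E (V - {p})" using two pQ by (auto simp: two_connected_def)
    moreover have "D \<subseteq> V - {p}" "w \<in> V - {p} - D" using D_sub pQ w by (auto simp: W_def)
    ultimately obtain a b where "a \<in> D" "b \<in> V - {p} - D" "E a b"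
      using connected_on_leaving_edge x by metis
    then show thesis using that[of a] D_N[of a] sym by auto
  qed
  obtain x1 where x1: "x1 \<in> D" "E p x1" using p sym unfolding T_def by blast
  have out: "A = N x" if "A \<subseteq> N x" "x \<in> V" "card A \<ge> k" for A x
    using that finN cardN card_seteq by metis
  show False
  proof (cases "card D < k")
    case True
    \<comment> \<open>\<open>N x\<close> has \<open>k\<close> elements and lies in a set of at most
      \<open>k\<close>, so equality holds and \<open>x\<close> is adjacent to
      \<open>v\<close>.\<close>
    have "D \<subseteq> N v"
    proof
      fix x assume x: "x \<in> D"
      have "card (D - {x} \<union> {p, v}) = card (D - {x}) + card {p, v}"
        using finD pQ vD by (intro card_Un_disjoint) auto
      also have "\<dots> \<le> k" using True x finD pQ k_ge_3 by simp
      finally have "N x = D - {x} \<union> {p, v}"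
        using D_N[OF x] finD cardN[of x] x D_sub by (intro card_seteq) auto
      then show "x \<in> N v" using sym by blast
    qed
    then have "D \<union> {u, z} \<subseteq> N v" using vz vu by auto
    then have "card (D \<union> {u, z}) \<le> k" using card_mono[OF finN] cardN[OF vV] by metis
    moreover have "card (D \<union> {u, z}) = card D + 2"
      using finD zu uz_Q D_sub by (subst card_Un_disjoint) auto
    moreover have "k \<le> card D + 1"
    proof -
      have "k \<le> card (D - {x0} \<union> {p, v})"
        using card_mono[OF _ D_N[OF x0(1)]] finD cardN[of x0] x0 D_sub by auto
      also have "\<dots> \<le> card (D - {x0}) + card {p, v}" by (rule card_Un_le)
      also have "\<dots> = card D + 1" using x0 finD pQ by (simp add: card_gt_0_iff) (metis Suc_pred card_gt_0_iff empty_iff)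
      finally show ?thesis .
    qed
    ultimately show False by simp
  next
    case False
    then have cWk: "card W \<le> k - 1" using cW small by simp
    have W_all: "W \<subseteq> N v \<inter> N p"
    proof
      fix x assume x: "x \<in> W"
      have xV: "x \<in> V" using x by (auto simp: W_def)
      have "card (W - {x} \<union> {p, v}) \<le> card (W - {x}) + card {p, v}" by (rule card_Un_le)
      also have "\<dots> \<le> k" using cWk x finW pQ k_ge_3 card_gt_0_iff[of W] by auto
      finally have "N x = W - {x} \<union> {p, v}"
        using W_N[OF x] finW cardN[OF xV] by (intro card_seteq) auto
      then show "x \<in> N v \<inter> N p" using sym by blast
    qed
    have cWk': "card W = k - 1"
    proof -
      obtain w where w: "w \<in> W" using uzW by blast
      then have wV: "w \<in> V" by (auto simp: W_def)
      have "k \<le> card (W - {w} \<union> {p, v})"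
        using card_mono[OF _ W_N[OF w]] finW cardN[OF wV] by simp
      also have "\<dots> \<le> card (W - {w}) + card {p, v}" by (rule card_Un_le)
      also have "\<dots> \<le> card W + 1" using w finW pQ card_gt_0_iff[of W] by auto
      finally show ?thesis using cWk by simp
    qed
    have ins: "card (insert x W) = k" if "x \<in> D" for x
      using that finW cWk' k_ge_3 by (subst card_insert_disjoint) (auto simp: W_def)
    \<comment> \<open>\<open>p\<close> and \<open>v\<close> have \<open>k - 1\<close> neighbours in
      \<open>W\<close> each, leaving room for just one in \<open>D\<close>. A further vertex of
      \<open>D\<close> then has all its neighbours in \<open>D\<close>, which makes
      \<open>card V\<close> too large.\<close>
    have Nv: "insert x0 W = N v" using W_all x0 ins[OF x0(1)] vV by (intro out) auto
    have Np: "insert x1 W = N p" using W_all x1 ins[OF x1(1)] pQ by (intro out) auto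
    have "\<not> D \<subseteq> {x0, x1}"
    proof
      assume "D \<subseteq> {x0, x1}"
      then have "card D \<le> card {x0, x1}" by (intro card_mono) auto
      also have "\<dots> \<le> 2" by (simp add: card_insert_if)
      finally show False using False k_ge_3 by simp
    qed
    then obtain x2 where x2: "x2 \<in> D" "x2 \<noteq> x0" "x2 \<noteq> x1" by auto
    have "\<not> E x2 v" "\<not> E x2 p" using Nv Np x2 sym by (auto simp: W_def)
    then have "N x2 \<subseteq> D - {x2}" using D_N[OF x2(1)] by auto
    then have "card (N x2) \<le> card (D - {x2})" using finD by (intro card_mono) auto
    then have "k \<le> card D - 1" using x2 finD D_sub cardN[of x2] by auto
    then show False using cWk' cW small k_ge_3 by simp
  qed
qed

lemma card_T_ge_2: "card T \<ge> 2"
  using card_T_ne_1 T_ne finT by (metis One_nat_def Suc_leI card_gt_0_iff le_neq_implies_less numeral_2_eq_2)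

text \<open>Otherwise \<open>u\<close>, \<open>v\<close>, \<open>z\<close> would separate
  \<open>D\<close> from the remaining vertices. If there are none, \<open>Q\<close> is the edge
  \<open>zu\<close>, whose ends cannot both be attachments.\<close>

lemma T_not_ends: "\<not> T \<subseteq> {u, z}"
proof
  assume sub: "T \<subseteq> {u, z}"
  obtain x where x: "x \<in> D" using D_ne by blast
  have DS: "D \<subseteq> V - {u, v, z}" using D_sub uz_Q by auto
  show False
  proof (cases "D = V - {u, v, z}")
    case True
    have "set Q \<subseteq> {u, z}" using True D_sub subQ by auto
    then have "length Q \<le> 2"
      using distinct_card[OF distQ] card_mono[of "{u, z}" "set Q"] by (auto simp: card_insert_if split: if_splits)
    then have m: "length Q = 2" using length_Q_ge_2 by simp
    have "T = {u, z}" using sub card_T_ge_2 zu by (intro card_seteq) auto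
    moreover have "Q ! 0 = z" "Q ! 1 = u" using hdQ lastQ neQ m by (auto simp: hd_conv_nth last_conv_nth)
    ultimately show False using no_consec[of 0] m by auto
  next
    case False
    then obtain y where "y \<in> V - {u, v, z} - D" using DS by blast
    then obtain a b where ab: "a \<in> D" "b \<in> V - {u, v, z} - D" "E a b"
      using connected_on_leaving_edge[OF conn3 DS x] by metis
    then have "b \<in> T" using D_nbr[of a b] by (auto simp: T_def)
    then show False using sub ab by auto
  qed
qed

text \<open>Otherwise \<open>T\<close> would be \<open>{u, z}\<close>. This provides two successors
  or two predecessors of attachments, as only \<open>u\<close> lacks a successor and only
  \<open>z\<close> a predecessor.\<close>

lemma two_off_an_end: "card (T - {u}) \<ge> 2 \<or> card (T - {z}) \<ge> 2"
proof (rule ccontr)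
  assume *: "\<not> ?thesis"
  have "u \<in> T" "z \<in> T" using * card_T_ge_2 by (metis Diff_empty Diff_insert0)+
  moreover have "card T = 2"
    using * card_T_ge_2 card_Diff_singleton[OF \<open>u \<in> T\<close>] by linarith
  ultimately have "{u, z} = T" using finT zu by (intro card_seteq) auto
  then show False using T_not_ends by auto
qed

lemma card_succs_T: "card (succs Q T) = card (T - {u})"
  using card_succs[OF distQ T_sub neQ] lastQ by simp

lemma card_D_if_succs:
  assumes "card (T - {u}) \<ge> 2"
  shows "2 * k + card D \<le> card V + 2"
proof -
  have "card (succs Q T) \<ge> 2" using assms card_succs_T by simp
  then obtain y y' where "y \<in> succs Q T" "y' \<in> succs Q T" "y \<noteq> y'"
    by (rule two_le_cardE)
  then have "2 * k + card D \<le> card V + of_bool (E v y) + of_bool (E v y')" by (rule succs_degree_sum)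
  also have "\<dots> \<le> card V + 2" by (simp add: of_bool_def)
  finally show ?thesis .
qed

interpretation rv: longest_path_comp V E k v u z "rev Q" D
  by (rule comp_reversed)

lemma rv_T: "rv.T = T" by (simp add: rv.T_def T_def)

text \<open>Together with \<open>card V <= 2 * k + 1\<close> this leaves at most three vertices in
  \<open>D\<close>.\<close>

lemma card_D: "2 * k + card D \<le> card V + 2"
  using two_off_an_end card_D_if_succs rv.card_D_if_succs rv_T by metis

end

section \<open>Components are single vertices\<close>

context longest_path_comp begin

lemma degree_into_Q:
  assumes "x \<in> D"
  shows "k + 1 \<le> card (N x \<inter> set Q) + card D + of_bool (E v x)"
proof -
  have "x \<in> V" using assms D_sub by auto
  moreover have "N x \<inter> (R - D) = {}" using D_nbr[OF assms] by auto
  moreover have "card (N x \<inter> D) \<le> card (D - {x})" using finD irr by (intro card_mono) auto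
  moreover have "card (D - {x}) + 1 = card D" using assms finD by (metis Suc_eq_plus1 card_Suc_Diff1)
  ultimately show ?thesis using nbr_partition[of x] by simp
qed

lemma nbrs_in_T: "x \<in> D \<Longrightarrow> N x \<inter> set Q \<subseteq> T" by (auto simp: T_def)

text \<open>The vertex \<open>u\<close> has no successor, but it can stand in for one: being
  adjacent to \<open>v\<close>, it counts equally well towards \<open>N v\<close>.\<close>

lemma card_succs_Un_u:
  assumes "S \<subseteq> T" shows "card S \<le> card (succs Q S \<union> {u})"
proof -
  have fin: "finite (succs Q S)" by simp
  have c: "card (succs Q S) = card (S - {u})"
    using card_succs[OF distQ _ neQ] assms T_sub lastQ by auto
  have finS: "finite S" using assms finT finite_subset by blast
  show ?thesis
  proof (cases "u \<in> S")
    case True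
    then have "u \<notin> succs Q S" using succs_disj succs_mono[OF assms, of Q] assms by blast
    then show ?thesis using c fin True finS card_Suc_Diff1[of S u] by simp
  next
    case False
    then show ?thesis using c card_insert_le[of "succs Q S" u] by simp
  qed
qed

lemma card_bad_succs:
  assumes "card V < 2 * k + card D" shows "card (succs Q T - N v) \<le> 1"
proof (rule ccontr)
  assume "\<not> ?thesis"
  then have "card (succs Q T - N v) \<ge> 2" by simp
  then obtain y y' where "y \<in> succs Q T - N v" "y' \<in> succs Q T - N v" "y \<noteq> y'"
    by (rule two_le_cardE)
  then show False using succs_degree_sum[of y y'] assms by simp
qed

lemma no_bad_succs:
  assumes "card V + 1 < 2 * k + card D" "card (T - {u}) \<ge> 2" shows "succs Q T \<subseteq> N v"
proof
  fix y assume y: "y \<in> succs Q T"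
  have "\<not> succs Q T \<subseteq> {y}" using assms(2) card_succs_T card_mono[of "{y}" "succs Q T"] by auto
  then obtain y' where "y' \<in> succs Q T" "y \<noteq> y'" by blast
  then have "2 * k + card D \<le> card V + of_bool (E v y) + of_bool (E v y')"
    using succs_degree_sum y by blast
  then show "y \<in> N v" using assms(1) by (auto simp: of_bool_def split: if_splits)
qed

text \<open>\<open>N v\<close> contains, disjointly, \<open>z\<close>, all but at most
  \<open>e\<close> members of \<open>succs Q T \<union> {u}\<close>, and
  \<open>N v \<inter> D\<close>.\<close>

lemma v_count_succs:
  assumes "card (succs Q T - N v) \<le> e"
  shows "card T + 1 + card (N v \<inter> D) \<le> k + e"
proof -
  let ?S = "succs Q T \<union> {u}"
  have fin: "finite ?S" by simp
  have sub: "insert z (?S \<inter> N v) \<union> (N v \<inter> D) \<subseteq> N v" using vz by auto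
  have "card ?S \<le> card (?S \<inter> N v) + card (?S - N v)"
    using card_Un_le[of "?S \<inter> N v" "?S - N v"] by (simp add: Int_Diff_Un)
  moreover have "card (?S - N v) \<le> e"
  proof -
    have "?S - N v = succs Q T - N v" using vu by auto
    then show ?thesis using assms by simp
  qed
  moreover have "card T \<le> card ?S" by (rule card_succs_Un_u) simp
  moreover have "z \<notin> ?S" using hd_notin_succs[OF distQ] hdQ zu by auto
  then have "card (insert z (?S \<inter> N v)) = card (?S \<inter> N v) + 1" using fin by simp
  moreover have "card (insert z (?S \<inter> N v) \<union> (N v \<inter> D)) = card (insert z (?S \<inter> N v)) + card (N v \<inter> D)"
    using fin finD uz_Q D_sub succs_subset[of Q T] by (intro card_Un_disjoint) auto
  moreover have "card (insert z (?S \<inter> N v) \<union> (N v \<inter> D)) \<le> k"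
    using card_mono[OF finN sub] cardN[OF vV] by simp
  ultimately show ?thesis by linarith
qed

interpretation rv: longest_path_comp V E k v u z "rev Q" D
  by (rule comp_reversed)

text \<open>For \<open>card D >= 2\<close>, the sum \<open>2 * k + card D\<close> is
  \<open>card V + 2\<close> or \<open>card V + 1\<close>. In the first case all successors or all
  predecessors of \<open>T\<close> are adjacent to \<open>v\<close>; in the second at most one
  successor is not.\<close>

lemma v_count:
  assumes "card D \<ge> 2"
  shows "card T + card (N v \<inter> D) + 2 * k + card D \<le> k + 1 + card V"
proof (cases "card V + 1 < 2 * k + card D")
  case True
  have "card T + 1 + card (N v \<inter> D) \<le> k + 0"
    using two_off_an_end
  proof
    assume "card (T - {u}) \<ge> 2"
    then have "succs Q T - N v = {}" using no_bad_succs True by blast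
    then show ?thesis by (intro v_count_succs) (simp only: card.empty)
  next
    assume "card (T - {z}) \<ge> 2"
    then have "succs (rev Q) rv.T - N v = {}" using rv.no_bad_succs True by (simp add: rv_T)
    then have "card rv.T + 1 + card (N v \<inter> D) \<le> k + 0"
      by (intro rv.v_count_succs) (simp only: card.empty)
    then show ?thesis by (simp add: rv_T)
  qed
  then show ?thesis using card_D by simp
next
  case False
  then have "card V + 1 = 2 * k + card D" using assms small by simp
  moreover have "card T + 1 + card (N v \<inter> D) \<le> k + 1"
    using \<open>card V + 1 = _\<close> by (intro v_count_succs card_bad_succs) simp
  ultimately show ?thesis by simp
qed

text \<open>Excluding distance two on \<open>Q\<close> keeps the successors of \<open>S\<close>
  apart from its predecessors, so that both can be counted.\<close>

definition spread :: "'a set \<Rightarrow> bool" where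
  "spread S \<longleftrightarrow> (\<forall>i. Suc (Suc i) < length Q \<longrightarrow> \<not> (Q ! i \<in> S \<and> Q ! Suc (Suc i) \<in> S))"

lemma spread_disj: "spread S \<Longrightarrow> succs Q S \<inter> preds Q S = {}"
proof (rule ccontr)
  assume s: "spread S" and "\<not> ?thesis"
  then obtain i j where ij: "Q ! Suc i = Q ! j" "Suc i < length Q" "Suc j < length Q" "Q ! i \<in> S" "Q ! Suc j \<in> S"
    by (auto simp: succs_def preds_def)
  then have "j = Suc i" using distQ by (simp add: nth_eq_iff_index_eq)
  then show False using s ij by (auto simp: spread_def)
qed

lemma preds_disj: "T \<inter> preds Q T = {}"
  using rv.succs_disj by (simp add: rv_T succs_rev)

lemma card_preds_S: "S \<subseteq> T \<Longrightarrow> card (preds Q S) = card (S - {z})"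
  using card_succs[of "rev Q" S] distQ neQ T_sub hdQ by (simp add: succs_rev last_rev)

text \<open>\<open>S\<close>, its successors and its predecessors are disjoint subsets of
  \<open>Q\<close>; \<open>u\<close> has no successor and \<open>z\<close> no predecessor.\<close>

lemma spread_card:
  assumes "S \<subseteq> T" "spread S"
  shows "3 * card S \<le> length Q + of_bool (u \<in> S) + of_bool (z \<in> S)"
proof -
  have fin: "finite (succs Q S)" "finite (preds Q S)" "finite S"
    using finite_subset[OF assms(1) finT] by simp_all
  have d: "succs Q S \<inter> preds Q S = {}" "S \<inter> succs Q S = {}" "S \<inter> preds Q S = {}"
    using spread_disj[OF assms(2)] succs_disj preds_disj succs_mono[OF assms(1), of Q]
      preds_mono[OF assms(1)] assms(1) by blast+
  have "card (S \<union> succs Q S \<union> preds Q S) = card S + card (succs Q S) + card (preds Q S)"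
    using d fin by (subst card_Un_disjoint, auto simp: card_Un_disjoint)
  moreover have "card (S \<union> succs Q S \<union> preds Q S) \<le> card (set Q)"
    using succs_subset[of Q S] preds_subset[of Q S] assms(1) T_sub by (intro card_mono) auto
  moreover have "card (succs Q S) = card (S - {u})"
    using card_succs[OF distQ _ neQ] assms T_sub lastQ by auto
  ultimately show ?thesis using card_preds_S[OF assms(1)] distinct_card[OF distQ]
    card_minus_of_bool[OF fin(3), of u] card_minus_of_bool[OF fin(3), of z] by linarith
qed

text \<open>Successors with \<open>u\<close> and predecessors with \<open>z\<close> are disjoint as
  \<open>S\<close> is spread, and each of the two sets contains at least \<open>card S - e\<close>
  neighbours of \<open>v\<close>.\<close>

lemma v_count_two_sided:
  assumes "S \<subseteq> T" "spread S" "card (succs Q S - N v) \<le> e" "card (preds Q S - N v) \<le> e"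
  shows "2 * card S + card (N v \<inter> D) \<le> k + 2 * e"
proof -
  let ?A = "succs Q S \<union> {u}" and ?B = "preds Q S \<union> {z}"
  have fin: "finite ?A" "finite ?B" by simp_all
  have eq: "?A - N v = succs Q S - N v" "?B - N v = preds Q S - N v" using vu vz by auto
  have A: "card ?A \<le> card (?A \<inter> N v) + e"
    using card_Un_le[of "?A \<inter> N v" "?A - N v"] assms(3) eq(1) by (simp add: Int_Diff_Un)
  have B: "card ?B \<le> card (?B \<inter> N v) + e"
    using card_Un_le[of "?B \<inter> N v" "?B - N v"] assms(4) eq(2) by (simp add: Int_Diff_Un)
  have cA: "card S \<le> card ?A" using card_succs_Un_u assms(1) by blast
  have cB: "card S \<le> card ?B" using rv.card_succs_Un_u[of S] assms(1) by (simp add: rv_T succs_rev)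
  have "z \<notin> ?A" using hd_notin_succs[OF distQ] hdQ zu by auto
  moreover have "u \<notin> ?B" using hd_notin_succs[of "rev Q" S] distQ lastQ zu by (auto simp: succs_rev hd_rev)
  ultimately have AB: "?A \<inter> ?B = {}" using spread_disj[OF assms(2)] by blast
  have "card (?A \<inter> N v) + card (?B \<inter> N v) + card (N v \<inter> D)
      = card ((?A \<inter> N v) \<union> (?B \<inter> N v) \<union> (N v \<inter> D))"
    using fin finD AB uz_Q D_sub succs_subset[of Q S] preds_subset[of Q S]
    by (subst card_Un_disjoint, simp, simp, blast, subst card_Un_disjoint) auto
  also have "\<dots> \<le> card (N v)" using finN by (intro card_mono) auto
  finally show ?thesis using A B cA cB cardN[OF vV] by linarith
qed

text \<open>By \<open>gap2\<close>, two attachments at distance two would both be adjacent to the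
  same one of \<open>x\<close>, \<open>y\<close> and not to the other, but each difference has at
  most one element.\<close>

lemma spread_union:
  assumes xy: "x \<in> D" "y \<in> D" "x \<noteq> y"
    and "card (N x \<inter> set Q - N y) \<le> 1" "card (N y \<inter> set Q - N x) \<le> 1"
  shows "spread (N x \<inter> set Q \<union> N y \<inter> set Q)"
  unfolding spread_def
proof (intro allI impI notI)
  fix i assume i: "Suc (Suc i) < length Q"
    and in2: "Q ! i \<in> N x \<inter> set Q \<union> N y \<inter> set Q \<and> Q ! Suc (Suc i) \<in> N x \<inter> set Q \<union> N y \<inter> set Q"
  have ne: "Q ! i \<noteq> Q ! Suc (Suc i)" using distQ i by (simp add: nth_eq_iff_index_eq)
  have 1: "\<not> (E x (Q ! i) \<and> E y (Q ! Suc (Suc i)))" "\<not> (E y (Q ! i) \<and> E x (Q ! Suc (Suc i)))"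
    using gap2 xy i by blast+
  then have "{Q ! i, Q ! Suc (Suc i)} \<subseteq> N x \<inter> set Q - N y \<or> {Q ! i, Q ! Suc (Suc i)} \<subseteq> N y \<inter> set Q - N x"
    using in2 by auto
  then have "card {Q ! i, Q ! Suc (Suc i)} \<le> 1"
    using card_mono[of "N x \<inter> set Q - N y" "{Q ! i, Q ! Suc (Suc i)}"]
      card_mono[of "N y \<inter> set Q - N x" "{Q ! i, Q ! Suc (Suc i)}"] assms(4,5) finN
    by (meson finite_Diff finite_Int le_trans)
  then show False using ne by simp
qed

text \<open>The successor of the first attachment is forced to be adjacent to the second attachment, which then
  has five neighbours.\<close>

lemma degree_four_indexed:
  assumes k4: "k = 4" and xy: "x \<in> D" "y \<in> D" "x \<noteq> y"
    and ab: "a < b" "Suc b < length Q"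
    and E4: "E x (Q ! a)" "E x (Q ! b)" "E y (Q ! a)" "E y (Q ! b)"
    and d: "of_bool (E v (Q ! Suc a)) + 2 \<le> card D"
  shows False
proof -
  let ?y = "Q ! Suc a"
  obtain ds where "linked E R (Q ! a) ds (Q ! b)" "length ds \<ge> 2"
    using obtain_link[OF xy(1,2) E4(1,4)] xy(3) by metis
  \<comment> \<open>This makes \<open>?y\<close> and \<open>Q ! (b - 1)\<close> different, as the
    final count of five requires.\<close>
  then have gap3: "Suc (Suc a) < b" using gap[of a b ds] ab by simp
  have ys: "?y \<in> succs Q T" "Q ! Suc b \<in> succs Q T"
    using xy E4 ab unfolding succs_def T_def by auto
  have yV: "?y \<in> V" using nthQ_V ab by simp
  have ND: "N ?y \<inter> D = {}" using succs_no_D[OF ys(1)] sym by blast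
  \<comment> \<open>Otherwise \<open>?y\<close> has at most \<open>length Q - 3\<close> neighbours
    on \<open>Q\<close>, hence at most \<open>5 - card D + of_bool (E v ?y) <= 3\<close> in
    all.\<close>
  have "E ?y (Q ! b)"
  proof (rule ccontr)
    assume no: "\<not> E ?y (Q ! b)"
    have "N ?y \<inter> set Q \<subseteq> set Q - {?y, Q ! b, Q ! Suc b}"
      using no succs_indep[OF ys] irr by auto
    then have "card (N ?y \<inter> set Q) \<le> card (set Q - {?y, Q ! b, Q ! Suc b})"
      by (intro card_mono) auto
    also have "\<dots> = card (set Q) - card {?y, Q ! b, Q ! Suc b}"
      using ab by (intro card_Diff_subset) auto
    also have "card {?y, Q ! b, Q ! Suc b} = 3" using ab gap3 by (simp add: nth_Q_eq_iff)
    finally have "card (N ?y \<inter> set Q) + 3 \<le> length Q" using ab gap3 distinct_card[OF distQ] by simp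
    moreover have "card (N ?y \<inter> (R - D)) \<le> card (R - D)" using finV by (intro card_mono) auto
    ultimately show False
      using nbr_partition[OF yV] card_RD small k4 d ND by simp
  qed
  then have "{x, y, ?y, Q ! (b - 1), Q ! Suc b} \<subseteq> N (Q ! b)"
    using E4 sym E_nth[of "b - 1"] E_nth[of b] ab gap3 by auto
  then have "card {x, y, ?y, Q ! (b - 1), Q ! Suc b} \<le> 4"
    using card_mono[OF finN] cardN[OF nthQ_V[of b]] ab k4 by (metis Suc_lessD)
  moreover have "card {x, y, ?y, Q ! (b - 1), Q ! Suc b} = 5"
  proof -
    have "w \<noteq> Q ! i" if "w \<in> D" "i < length Q" for w i using that D_sub nth_mem by blast
    then have "distinct [x, y, ?y, Q ! (b - 1), Q ! Suc b]"
      using xy gap3 ab by (simp add: nth_Q_eq_iff) linarith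
    from distinct_card[OF this] show ?thesis by simp
  qed
  ultimately show False by simp
qed

lemma degree_four_succs:
  assumes k4: "k = 4" and xy: "x \<in> D" "y \<in> D" "x \<noteq> y"
    and S: "card S = 2" "S \<subseteq> N x \<inter> set Q" "S \<subseteq> N y" "u \<notin> S"
    and d: "card D \<ge> 2" "card D \<ge> 3 \<or> N v \<subseteq> D \<union> {u, z}"
  shows False
proof -
  obtain p q where pq: "S = {p, q}" "p \<noteq> q" using S(1) by (auto simp: card_2_iff)
  obtain i j where ij: "i < length Q" "Q ! i = p" "j < length Q" "Q ! j = q"
    using pq S(2) by (auto simp: in_set_conv_nth)
  obtain a b where ab: "a < b" "b < length Q" "S = {Q ! a, Q ! b}"
  proof -
    consider "i < j" | "j < i" using ij pq(2) by (metis linorder_neqE_nat)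
    then show thesis
      by cases (use that[of i j] that[of j i] ij pq in \<open>auto simp: insert_commute\<close>)
  qed
  have sb: "Suc b < length Q"
  proof (rule ccontr)
    assume "\<not> ?thesis"
    then have "b = length Q - 1" using ab by simp
    then show False using S(4) lastQ neQ ab(3) by (simp add: last_conv_nth)
  qed
  \<comment> \<open>If \<open>card D = 2\<close>, all neighbours of \<open>v\<close> lie in
    \<open>D \<union> {u, z}\<close>, so the indicator vanishes.\<close>
  have "of_bool (E v (Q ! Suc a)) + 2 \<le> card D"
  proof (cases "card D \<ge> 3")
    case False
    have "Q ! Suc a \<noteq> z" "Q ! Suc a \<noteq> u" "Q ! Suc a \<notin> D"
      using hdQ lastQ neQ distQ ab sb D_sub nth_mem[of "Suc a" Q]
      by (auto simp: hd_conv_nth last_conv_nth nth_eq_iff_index_eq)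
    then show ?thesis using d False by auto
  qed (simp add: of_bool_def)
  then show False using degree_four_indexed[OF k4 xy ab(1) sb] S ab(3) by auto
qed

end

context longest_path_comp begin

interpretation rv: longest_path_comp V E k v u z "rev Q" D
  by (rule comp_reversed)

lemma degree_four:
  assumes k4: "k = 4" and xy: "x \<in> D" "y \<in> D" "x \<noteq> y"
    and S: "card S = 2" "S \<subseteq> N x \<inter> set Q" "S \<subseteq> N y" "u \<notin> S \<or> z \<notin> S"
    and d: "card D \<ge> 2" "card D \<ge> 3 \<or> N v \<subseteq> D \<union> {u, z}"
  shows False
  using S(4) degree_four_succs[OF k4 xy S(1-3) _ d] rv.degree_four_succs[OF k4 xy S(1) _ S(3) _ d(1)] S(2) d(2)
  by (auto simp: insert_commute)

lemma T_eq_ends: "card T = 2 \<Longrightarrow> u \<in> T \<Longrightarrow> z \<in> T \<Longrightarrow> False"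
  using card_seteq[of T "{u, z}"] finT zu T_not_ends by auto

lemma spread_nbrs:
  assumes "x \<in> D" "y \<in> D" "x \<noteq> y" "card (N x \<inter> set Q \<union> N y \<inter> set Q) \<le> card (N x \<inter> set Q) + 1"
    "card (N x \<inter> set Q \<union> N y \<inter> set Q) \<le> card (N y \<inter> set Q) + 1"
  shows "spread (N x \<inter> set Q \<union> N y \<inter> set Q)"
proof (rule spread_union[OF assms(1-3)])
  have "card (N x \<inter> set Q - N y \<inter> set Q) \<le> 1"
    using assms finN by (intro card_diff_bound) auto
  moreover have "N x \<inter> set Q - N y = N x \<inter> set Q - N y \<inter> set Q" by auto
  ultimately show "card (N x \<inter> set Q - N y) \<le> 1" by simp
  have "card (N y \<inter> set Q - N x \<inter> set Q) \<le> 1"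
    using assms finN by (intro card_diff_bound) (auto simp: Un_commute)
  moreover have "N y \<inter> set Q - N x = N y \<inter> set Q - N x \<inter> set Q" by auto
  ultimately show "card (N y \<inter> set Q - N x) \<le> 1" by simp
qed

text \<open>The count at \<open>v\<close> forces \<open>x\<close> and \<open>y\<close> to share
  nearly all of \<open>T\<close>, so \<open>T\<close> is spread. Degrees and the two spread counts
  then leave only \<open>k = 3\<close> with \<open>T = {u, z}\<close>, or \<open>k = 4\<close> with
  \<open>N v = D \<union> {u, z}\<close>.\<close>

lemma D_not_pair: "card D \<noteq> 2"
proof
  assume d2: "card D = 2"
  then obtain x y where D: "D = {x, y}" "x \<noteq> y" by (auto simp: card_2_iff)
  have xy: "x \<in> D" "y \<in> D" using D by auto
  let ?A = "N x \<inter> set Q" and ?B = "N y \<inter> set Q"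
  have TAB: "T = ?A \<union> ?B" unfolding T_def using D by auto
  have fin: "finite ?A" "finite ?B" by auto
  have delta: "card (N v \<inter> D) = of_bool (E v x) + of_bool (E v y)"
    using D by (auto simp: Int_insert_right)
  have degs: "k \<le> card ?A + 1 + of_bool (E v x)" "k \<le> card ?B + 1 + of_bool (E v y)"
    using degree_into_Q[OF xy(1)] degree_into_Q[OF xy(2)] d2 by auto
  have le: "card ?A \<le> card T" "card ?B \<le> card T" using TAB finT by (auto intro: card_mono)
  have cnt: "card T + card (N v \<inter> D) + k + 1 \<le> card V" using v_count d2 by simp
  have m: "length Q + 3 \<le> card V" using card_RD d2 by simp
  have sp: "spread T"
    unfolding TAB using degs cnt delta small TAB by (intro spread_nbrs[OF xy D(2)]) auto
  have sc: "3 * card T \<le> length Q + of_bool (u \<in> T) + of_bool (z \<in> T)"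
    using spread_card sp by blast
  have b2: "of_bool (u \<in> T) + of_bool (z \<in> T) \<le> (2::nat)" by (simp add: of_bool_def)
  show False
  proof (cases "card V \<le> 2 * k")
    case True
    then have "\<not> E v x" "\<not> E v y" using cnt degs le delta by (auto simp: of_bool_def split: if_splits)
    then show False using degs le sc b2 m True k_ge_3 by simp
  next
    case False
    then have n: "card V = 2 * k + 1" using small by simp
    show False
    proof (cases "E v x \<and> E v y")
      case False
      then have "k \<le> card T + 1" using degs le by (auto simp: of_bool_def split: if_splits)
      then have "k = 3" "card T = 2" "u \<in> T" "z \<in> T"
        using sc m n k_ge_3 card_T_ge_2 by (auto simp: of_bool_def split: if_splits)
      then show False using T_eq_ends by blast
    next
      case True
      then have ct: "card T + 2 = k" "card ?A = card T" "card ?B = card T" using degs le cnt n delta by auto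
      have "card (succs Q T - N v) \<le> 1" "card (preds Q T - N v) \<le> 1"
        using card_bad_succs rv.card_bad_succs n d2 by (auto simp: rv_T succs_rev)
      then have "2 * card T + 2 \<le> k + 2 * 1" using v_count_two_sided[of T 1] sp delta True by auto
      then have k4: "k = 4" "card T = 2" using ct card_T_ge_2 by auto
      have AB: "?A = T" "?B = T" using ct finT nbrs_in_T xy by (simp_all add: card_subset_eq)
      have "D \<union> {u, z} = N v"
      proof (rule card_subset_eq)
        have "card (D \<union> {u, z}) = card D + card {u, z}"
          using finD uz_Q D_sub by (intro card_Un_disjoint) auto
        then show "card (D \<union> {u, z}) = card (N v)" using d2 zu cardN[OF vV] k4 by simp
      qed (use finN vu vz True D in auto)
      then show False
        using degree_four[OF k4(1) xy D(2) k4(2)] AB d2 T_eq_ends[OF k4(2)] by auto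
    qed
  qed
qed

text \<open>Two vertices of \<open>D\<close> are not adjacent to \<open>v\<close>. Their attachments
  form a spread set \<open>S\<close> of at least \<open>k - 2\<close> elements, whence
  \<open>k <= 5\<close>; the three values are refuted separately.\<close>

lemma D_not_triple: "card D \<noteq> 3"
proof
  assume d3: "card D = 3"
  have n: "card V = 2 * k + 1" using card_D small d3 by simp
  have cnt: "card T + card (N v \<inter> D) + 1 \<le> k" using v_count d3 n by simp
  have m: "length Q + 3 \<le> 2 * k" using card_RD d3 n by simp
  have degs: "k \<le> card (N x \<inter> set Q) + 2 + of_bool (E v x)" if "x \<in> D" for x
    using degree_into_Q[OF that] d3 by simp
  have le: "card (N x \<inter> set Q) \<le> card T" if "x \<in> D" for x
    using nbrs_in_T[OF that] finT by (rule card_mono[rotated])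
  have part: "card (D - N v) + card (N v \<inter> D) = 3"
  proof -
    have "D = (D - N v) \<union> (N v \<inter> D)" by auto
    then have "card D = card (D - N v) + card (N v \<inter> D)"
      using finD card_Un_disjoint[of "D - N v" "N v \<inter> D"] by auto
    then show ?thesis using d3 by simp
  qed
  \<comment> \<open>By \<open>cnt\<close> and \<open>degs\<close>, one non-neighbour of
    \<open>v\<close> in \<open>D\<close> leaves at most one neighbour of \<open>v\<close> there,
    while \<open>D \<subseteq> N v\<close> would make \<open>card T\<close> less than
    \<open>k - 3\<close>.\<close>
  have "card (D - N v) \<ge> 2"
  proof (rule ccontr)
    assume *: "\<not> ?thesis"
    show False
    proof (cases "D - N v = {}")
      case True
      then have "card (D - N v) = 0" by (simp only: card.empty)
      then have "card (N v \<inter> D) = 3" using part by linarith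
      moreover obtain x where "x \<in> D" using D_ne by blast
      ultimately show False using cnt degs[of x] le[of x] by (auto simp: of_bool_def split: if_splits)
    next
      case False
      then obtain x where "x \<in> D" "\<not> E v x" by blast
      then show False using cnt degs[of x] le[of x] * part by simp
    qed
  qed
  then obtain x y where xy: "x \<in> D" "y \<in> D" "x \<noteq> y" and nv: "\<not> E v x" "\<not> E v y"
    by (rule two_le_cardE) auto
  let ?A = "N x \<inter> set Q" and ?B = "N y \<inter> set Q"
  define S where "S = ?A \<union> ?B"
  have ST: "S \<subseteq> T" using nbrs_in_T xy by (auto simp: S_def)
  have finS: "finite S" by (simp add: S_def)
  have cS: "card ?A \<le> card S" "card ?B \<le> card S" "card S \<le> card T"
    using finS finT ST by (auto simp: S_def intro!: card_mono)
  have kA: "k \<le> card ?A + 2" "k \<le> card ?B + 2" using degs xy nv by fastforce+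
  have sp: "spread S"
    unfolding S_def using kA cS cnt by (intro spread_nbrs[OF xy]) (auto simp: S_def)
  have sc: "3 * card S \<le> length Q + of_bool (u \<in> S) + of_bool (z \<in> S)"
    using spread_card[OF ST sp] .
  have b2: "of_bool (u \<in> S) + of_bool (z \<in> S) \<le> (2::nat)" by (simp add: of_bool_def)
  have "k \<le> 5" using kA cS sc b2 m by simp
  then consider "k = 3" | "k = 4" | "k = 5" using k_ge_3 by linarith
  then show False
  proof cases
    case 1
    have one: "card T + card (T - {u}) \<le> length Q"
    proof -
      have "card T + card (succs Q T) = card (T \<union> succs Q T)"
        using succs_disj finT finite_subset[OF succs_subset] by (subst card_Un_disjoint) auto
      also have "\<dots> \<le> card (set Q)" using T_sub succs_subset[of Q T] by (intro card_mono) auto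
      finally show ?thesis using card_succs_T distinct_card[OF distQ] by simp
    qed
    have two: "card T + card (T - {z}) \<le> length Q"
    proof -
      have "card T + card (preds Q T) = card (T \<union> preds Q T)"
        using preds_disj finT finite_subset[OF preds_subset] by (subst card_Un_disjoint) auto
      also have "\<dots> \<le> card (set Q)" using T_sub preds_subset[of Q T] by (intro card_mono) auto
      finally show ?thesis using card_preds_S[of T] distinct_card[OF distQ] by simp
    qed
    have "2 * card T \<le> 3 + of_bool (u \<in> T)"
      using one m 1 card_minus_of_bool[OF finT, of u] by linarith
    moreover have "2 * card T \<le> 3 + of_bool (z \<in> T)"
      using two m 1 card_minus_of_bool[OF finT, of z] by linarith
    ultimately have "u \<in> T" "z \<in> T" "card T = 2"
      using card_T_ge_2 by (simp_all add: of_bool_def split: if_splits)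
    then show False using T_eq_ends by blast
  next
    case 2
    have c2: "card S = 2" using 2 sc b2 m kA cS by simp
    have "?A \<subseteq> S" "?B \<subseteq> S" by (auto simp: S_def)
    moreover have "card S \<le> card ?A" "card S \<le> card ?B" using c2 kA 2 by linarith+
    ultimately have AB: "S = ?A" "S = ?B" using finS by (metis card_seteq)+
    show False
    proof (cases "u \<in> S \<and> z \<in> S")
      case False
      then show False using degree_four[OF 2 xy c2] AB d3 by auto
    next
      case True
      then have Suz: "S = {u, z}" using c2 finS zu by (intro card_seteq[symmetric]) auto
      obtain c w where c: "c \<in> T" "c \<notin> S" "w \<in> D" "E w c" using T_not_ends Suz by (auto simp: T_def)
      have adj: "E x p \<and> E y p" if "p \<in> S" for p using that AB by auto
      \<comment> \<open>One of \<open>x\<close>, \<open>y\<close> differs from \<open>w\<close> and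
        is adjacent to all of \<open>S\<close>, so \<open>gap2\<close> keeps \<open>c\<close> away
        from distance two.\<close>
      have "spread (insert c S)"
        unfolding spread_def
      proof (intro allI impI notI)
        fix i assume i: "Suc (Suc i) < length Q" and *: "Q ! i \<in> insert c S \<and> Q ! Suc (Suc i) \<in> insert c S"
        have ne: "Q ! i \<noteq> Q ! Suc (Suc i)" using distQ i by (simp add: nth_eq_iff_index_eq)
        obtain w' where w': "w' \<in> D" "w' \<noteq> w" "\<And>p. p \<in> S \<Longrightarrow> E w' p"
          using xy adj by (cases "w = x") auto
        from * ne consider "Q ! i \<in> S" "Q ! Suc (Suc i) \<in> S" | "Q ! i = c" "Q ! Suc (Suc i) \<in> S"
          | "Q ! i \<in> S" "Q ! Suc (Suc i) = c" by auto
        then show False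
        proof cases
          case 1 then show False using sp i by (auto simp: spread_def)
        next
          case 2 then show False using gap2[of w w' i] w' c i by auto
        next
          case 3 then show False using gap2[of w' w i] w' c i by auto
        qed
      qed
      then have "3 * card (insert c S) \<le> length Q + of_bool (u \<in> insert c S) + of_bool (z \<in> insert c S)"
        using c ST by (intro spread_card) auto
      also have "\<dots> \<le> length Q + 2" by (simp add: of_bool_def)
      finally show False using c c2 finS m 2 by simp
    qed
  next
    case 3
    have c3: "card S \<ge> 3" "card T \<ge> 3" using kA cS 3 by auto
    have "card (T - {u}) \<ge> 2" "card (T - {z}) \<ge> 2" using c3 by (auto simp: card_Diff_singleton_if)
    then have "succs Q T \<subseteq> N v" "preds Q T \<subseteq> N v"
      using no_bad_succs rv.no_bad_succs n d3 by (auto simp: rv_T succs_rev)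
    then have "succs Q S - N v = {}" "preds Q S - N v = {}"
      using succs_mono[OF ST, of Q] preds_mono[OF ST] by blast+
    then have "2 * card S + card (N v \<inter> D) \<le> k + 2 * 0"
      by (intro v_count_two_sided[OF ST sp]) (simp_all only: card.empty)
    then show False using 3 c3 by simp
  qed
qed

lemma D_singleton: "card D = 1"
  using D_not_pair D_not_triple card_D small D_ne finD card_gt_0_iff[of D] by linarith

end

section \<open>Isolated vertices off the path\<close>

context graph begin

definition arcs :: "'a set \<Rightarrow> 'a set \<Rightarrow> ('a \<times> 'a) set" where
  "arcs S S' = {(a, b). a \<in> S \<and> b \<in> S' \<and> E a b}"

text \<open>Every edge inside the set is counted twice.\<close>

definition inner :: "'a set \<Rightarrow> nat" where
  "inner S = card (arcs S S)"

lemma finite_arcs: "finite (arcs S S')"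
  by (rule finite_subset[of _ "V \<times> V"]) (use finV in \<open>auto simp: arcs_def dest: inV\<close>)

text \<open>The degree sums over \<open>S\<close> and over its complement are \<open>k\<close> times
  their sizes; the pairs between the two sides occur equally often in both and cancel.\<close>

lemma inner_balance:
  assumes "S \<subseteq> V"
  shows "inner S + k * card (V - S) = inner (V - S) + k * card S"
proof -
  define c where "c A B = card (arcs A B)" for A B
  have total: "c A V = k * card A" if "A \<subseteq> V" for A
  proof -
    have "arcs A V = Sigma A N" by (auto simp: arcs_def dest: inV)
    then have "c A V = (\<Sum>a\<in>A. card (N a))"
      using finite_subset[OF that finV] finN by (simp add: c_def card_SigmaI)
    also have "\<dots> = (\<Sum>a\<in>A. k)" by (rule sum.cong) (use that cardN in auto)
    finally show ?thesis by simp
  qed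
  have split: "c A V = c A S + c A (V - S)" for A
  proof -
    have "arcs A V = arcs A S \<union> arcs A (V - S)" "arcs A S \<inter> arcs A (V - S) = {}"
      using assms by (auto simp: arcs_def)
    then show ?thesis unfolding c_def by (simp add: card_Un_disjoint finite_arcs)
  qed
  have comm: "c A B = c B A" for A B
  proof -
    have "arcs B A = prod.swap ` arcs A B"
      by (auto simp: arcs_def intro: sym)
    then show ?thesis unfolding c_def by (simp add: card_image)
  qed
  have "c S S + c S (V - S) = k * card S" using split total assms by metis
  moreover have "c (V - S) S + c (V - S) (V - S) = k * card (V - S)" using split[of "V - S"] total[of "V - S"] by auto
  ultimately show ?thesis using comm[of S "V - S"] by (simp add: c_def inner_def)
qed

end

lemma (in longest_path) component_exists:
  assumes "x \<in> R"
  shows "\<exists>D. x \<in> D \<and> longest_path_comp V E k v z u Q D"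
proof -
  let ?r = "\<lambda>a b. a \<in> R \<and> b \<in> R \<and> E a b"
  define D where "D = {w. ?r\<^sup>*\<^sup>* x w}"
  have sub: "D \<subseteq> R"
  proof
    fix w assume "w \<in> D"
    then have "?r\<^sup>*\<^sup>* x w" by (simp add: D_def)
    then show "w \<in> R" using assms by (induction rule: rtranclp_induct) auto
  qed
  have symr: "?r\<^sup>*\<^sup>* b a" if "?r\<^sup>*\<^sup>* a b" for a b
    using that
  proof (induction rule: rtranclp_induct)
    case (step y w)
    then have "?r w y" using sym by blast
    then show ?case using step.IH by (rule converse_rtranclp_into_rtranclp)
  qed simp
  have closed: "w \<in> D" if "a \<in> D" "?r\<^sup>*\<^sup>* a w" for a w
    using that unfolding D_def by (auto intro: rtranclp_trans)
  have "longest_path_comp V E k v z u Q D"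
  proof
    show "D \<subseteq> V - {v} - set Q" by (rule sub)
    show "D \<noteq> {}" unfolding D_def by blast
    show "\<exists>ds. ds \<noteq> [] \<and> hd ds = a \<and> last ds = b \<and> distinct ds \<and> successively E ds \<and> set ds \<subseteq> D"
      if ab: "a \<in> D" "b \<in> D" for a b
    proof -
      have "?r\<^sup>*\<^sup>* a b" using ab symr[of x a] unfolding D_def by (auto intro: rtranclp_trans)
      then have "(\<lambda>c d. c \<in> D \<and> d \<in> D \<and> E c d)\<^sup>*\<^sup>* a b"
      proof (induction rule: rtranclp_induct)
        case (step y w)
        have "y \<in> D" "w \<in> D" using closed[OF ab(1)] step(1,2) by (auto intro: rtranclp.rtrancl_into_rtrancl)
        then show ?case using step by (auto intro: rtranclp.rtrancl_into_rtrancl)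
      qed simp
      then show ?thesis using rtranclp_imp_path[of D E a b] ab by blast
    qed
    show "y \<in> D \<union> set Q \<union> {v}" if "a \<in> D" "E a y" for a y
    proof (rule ccontr)
      assume no: "y \<notin> D \<union> set Q \<union> {v}"
      then have "?r a y" using that sub inV by auto
      then show False using no closed[OF that(1), of y] by auto
    qed
  qed
  moreover have "x \<in> D" by (simp add: D_def)
  ultimately show ?thesis by blast
qed

lemma (in longest_path) all_singletons:
  assumes "x \<in> R" shows "longest_path_comp V E k v z u Q {x}"
proof -
  obtain D where "x \<in> D" and D: "longest_path_comp V E k v z u Q D" using component_exists[OF assms] by blast
  moreover have "card D = 1" using longest_path_comp.D_singleton[OF D] .
  ultimately have "D = {x}" by (auto simp: card_1_singleton_iff)
  then show ?thesis using D by simp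
qed

lemma in_class_H_swap: "in_class_H V E k z v u \<longleftrightarrow> in_class_H V E k u v z"
proof -
  have "{z, v, u} = {u, v, z}" by auto
  then show ?thesis unfolding in_class_H_def by (simp only: conj_commute conj_left_commute)
qed

section \<open>An isolated vertex and its neighbourhood\<close>

locale isolated_vertex = longest_path_comp V E k v z u Q "{x}"
  for V :: "'a set" and E k v z u Q x +
  assumes notH: "\<not> in_class_H V E k u v z"
begin

lemma isolated_reversed: "isolated_vertex V E k v u z (rev Q) x"
  using comp_reversed notH unfolding isolated_vertex_def isolated_vertex_axioms_def
  by (simp add: in_class_H_swap)

lemma xR: "x \<in> R" using D_sub by simp

lemma T_eq: "T = N x \<inter> set Q" by (auto simp: T_def)

lemma R_indep:
  assumes "a \<in> R" "b \<in> R" shows "\<not> E a b"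
proof
  assume "E a b"
  interpret a: longest_path_comp V E k v z u Q "{a}" using all_singletons[OF assms(1)] .
  show False using a.D_nbr[of a b] \<open>E a b\<close> assms irr by auto
qed

lemma card_T_x: "card T + of_bool (E v x) = k"
proof -
  have "x \<in> V" using xR by auto
  moreover have "N x \<inter> {x} = {}" using irr by auto
  moreover have "N x \<inter> (R - {x}) = {}" using R_indep xR by blast
  ultimately show ?thesis using nbr_partition[of x] by (simp add: T_eq)
qed

text \<open>The independent set \<open>Y\<close> alone witnesses membership: take
  \<open>q = k\<close> and \<open>X = V - Y\<close>.\<close>

lemma class_H_contra:
  assumes "Y \<subseteq> V - {u, v, z}" "\<And>a b. a \<in> Y \<Longrightarrow> b \<in> Y \<Longrightarrow> \<not> E a b" "card Y = k" "card V = 2 * k + 1"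
  shows False
proof -
  have "in_class_H V E k u v z"
    unfolding in_class_H_def
  proof (rule exI[of _ k], rule exI[of _ "V - Y"], rule exI[of _ Y], intro conjI)
    show "card (V - Y) = k + 1"
      using assms finV finite_subset[of Y V] by (subst card_Diff_subset) auto
    show "nbhd_set E Y \<subseteq> V - Y" using assms(2) inV by (auto simp: nbhd_set_def)
    show "{u, v, z} \<subseteq> V - Y" using assms(1) inV vu vz by auto
    show "independent E Y" using assms(2) by (auto simp: independent_def)
  qed (use assms two reg vu vz in auto)
  then show False using notH by simp
qed

lemma card_Q_succs: "card (set Q - T - succs Q T) + 2 * card T = length Q + of_bool (u \<in> T)"
proof -
  have "card (set Q - T) = card (set Q) - card T" "card T \<le> card (set Q)"
    using T_sub finT by (simp_all add: card_Diff_subset card_mono)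
  moreover have "succs Q T \<subseteq> set Q - T" using succs_disj succs_subset[of Q T] by auto
  then have "card (set Q - T - succs Q T) = card (set Q - T) - card (succs Q T)"
    "card (succs Q T) \<le> card (set Q - T)"
    by (simp_all add: card_Diff_subset card_mono)
  ultimately show ?thesis
    using card_succs_T card_minus_of_bool[OF finT, of u] distinct_card[OF distQ] by linarith
qed

interpretation rv: isolated_vertex V E k v u z "rev Q" x
  by (rule isolated_reversed)

lemma card_Q_preds: "card (set Q - T - preds Q T) + 2 * card T = length Q + of_bool (z \<in> T)"
  using rv.card_Q_succs by (simp add: rv_T succs_rev)

lemma preds_indep: "y \<in> preds Q T \<Longrightarrow> y' \<in> preds Q T \<Longrightarrow> \<not> E y y'"
  using rv.succs_indep[of y y'] by (simp add: rv_T succs_rev)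

text \<open>Without this edge \<open>card T = k\<close>, and fitting \<open>T\<close> and its
  successors on \<open>Q\<close> forces both ends into \<open>T\<close> and
  \<open>card V = 2 * k + 1\<close>. Then \<open>x\<close> and these successors are \<open>k\<close>
  independent vertices avoiding \<open>u\<close>, \<open>v\<close>, \<open>z\<close>.\<close>

lemma E_v_x: "E v x"
proof (rule ccontr)
  assume "\<not> E v x"
  then have kT: "card T = k" using card_T_x by simp
  have "card R > 0" using xR finV by (auto simp: card_gt_0_iff)
  then have m: "length Q + 2 \<le> card V" using card_R by simp
  have *: "u \<in> T" "z \<in> T" "card V = 2 * k + 1"
    using card_Q_succs card_Q_preds kT m small by (auto simp: of_bool_def split: if_splits)
  have "\<not> E x b" "\<not> E b x" if "b \<in> succs Q T" for b using succs_no_D[OF that] sym by auto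
  moreover have "u \<notin> succs Q T" "z \<notin> succs Q T" "x \<notin> succs Q T" "v \<notin> succs Q T"
    using * succs_disj succs_subset[of Q T] xR v_notin_Q by auto
  moreover have "card (succs Q T) = k - 1" using card_succs_T kT * by simp
  moreover have "x \<noteq> u" "x \<noteq> z" "x \<noteq> v" "x \<in> V" using xR uz_Q by auto
  ultimately show False
    using succs_subset[of Q T] subQ irr k_ge_3 *(3) sym succs_indep
    by (intro class_H_contra[of "insert x (succs Q T)"]) auto
qed

lemma card_T: "card T + 1 = k" using card_T_x E_v_x by simp

abbreviation M where "M \<equiv> set Q - T"

definition P where "P = M - succs Q T"

definition L where "L = M - preds Q T"

lemma fin_PL: "finite P" "finite L" by (simp_all add: P_def L_def)

lemma card_P: "card P + 2 * k = length Q + 2 + of_bool (u \<in> T)"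
  using card_Q_succs card_T by (simp add: P_def)

lemma card_L: "card L + 2 * k = length Q + 2 + of_bool (z \<in> T)"
  using card_Q_preds card_T by (simp add: L_def)

lemma z_P: "z \<notin> T \<Longrightarrow> z \<in> P"
  using hd_notin_succs[OF distQ, of T] hdQ uz_Q by (auto simp: P_def)

lemma u_L: "u \<notin> T \<Longrightarrow> u \<in> L"
  using hd_notin_succs[of "rev Q" T] distQ lastQ uz_Q by (auto simp: L_def succs_rev hd_rev)

text \<open>An edge inside \<open>M\<close> has an end in \<open>P\<close> and an end in \<open>L\<close>, since successors and predecessors are
  independent; \<open>P\<close> and \<open>L\<close> have at most two elements.\<close>

lemma edge_in_M:
  assumes "a \<in> M" "b \<in> M" "E a b"
  shows "(a \<in> P \<or> b \<in> P) \<and> (a \<in> L \<or> b \<in> L)"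
  using assms succs_indep preds_indep by (auto simp: P_def L_def)

lemma inner_M:
  assumes "P \<inter> L = {}" shows "inner M \<le> 2 * (card P * card L)"
proof -
  have "arcs M M \<subseteq> P \<times> L \<union> L \<times> P"
    using edge_in_M assms by (auto simp: arcs_def)
  then have "inner M \<le> card (P \<times> L \<union> L \<times> P)"
    unfolding inner_def using fin_PL by (intro card_mono) auto
  also have "\<dots> \<le> card (P \<times> L) + card (L \<times> P)" by (rule card_Un_le)
  finally show ?thesis by (simp add: card_cartesian_product mult.commute)
qed

lemma nbrs_in_succs:
  assumes "r \<in> R - {x}" shows "card (N r \<inter> succs Q T) \<le> 1"
proof (rule ccontr)
  assume "\<not> ?thesis"
  then have "2 \<le> card (N r \<inter> succs Q T)" by simp
  then obtain y y' where "y \<in> N r \<inter> succs Q T" "y' \<in> N r \<inter> succs Q T" "y \<noteq> y'"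
    by (rule two_le_cardE)
  then show False using succs_no_common[of y y' r] assms sym by auto
qed

lemma nbrs_in_M_P:
  assumes "r \<in> R - {x}" shows "card (N r \<inter> M) \<le> 1 + card P"
proof -
  have "N r \<inter> M \<subseteq> (N r \<inter> succs Q T) \<union> P" by (auto simp: P_def)
  then have "card (N r \<inter> M) \<le> card ((N r \<inter> succs Q T) \<union> P)" using fin_PL by (intro card_mono) auto
  also have "\<dots> \<le> card (N r \<inter> succs Q T) + card P" by (rule card_Un_le)
  finally show ?thesis using nbrs_in_succs[OF assms] by simp
qed

end

context isolated_vertex begin

interpretation rv: isolated_vertex V E k v u z "rev Q" x
  by (rule isolated_reversed)

lemma rv_P: "rv.P = L" and rv_L: "rv.L = P"
  by (simp_all add: rv.P_def rv.L_def P_def L_def rv_T succs_rev preds_rev)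

lemma nbrs_in_M_L: "r \<in> R - {x} \<Longrightarrow> card (N r \<inter> M) \<le> 1 + card L"
  using rv.nbrs_in_M_P[of r] by (simp add: rv_P rv_T)

text \<open>Outside \<open>insert v T\<close> lie \<open>M\<close> and \<open>R\<close>. As
  \<open>R\<close> is independent and \<open>x\<close> has no neighbour in \<open>M\<close>, besides
  the pairs in \<open>M\<close> only those between \<open>R - {x}\<close> and \<open>M\<close>
  remain, in both orders.\<close>

lemma inner_outside:
  assumes B: "\<And>r. r \<in> R - {x} \<Longrightarrow> card (N r \<inter> M) \<le> B"
  shows "inner (V - insert v T) \<le> inner M + 2 * ((card R - 1) * B)"
proof -
  define F where "F = Sigma (R - {x}) (\<lambda>r. N r \<inter> M)"
  have finF: "finite F" using finV by (auto simp: F_def)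
  have "card F = (\<Sum>r\<in>R - {x}. card (N r \<inter> M))" unfolding F_def using finV by (intro card_SigmaI) auto
  also have "\<dots> \<le> (\<Sum>r\<in>R - {x}. B)" using B by (rule sum_mono)
  finally have cF: "card F \<le> (card R - 1) * B" using xR finV by simp
  have "arcs (V - insert v T) (V - insert v T) \<subseteq> arcs M M \<union> (F \<union> prod.swap ` F)" (is "?L \<subseteq> _")
  proof (rule subrelI)
    fix a b assume "(a, b) \<in> ?L"
    then have ab: "a \<in> V" "a \<noteq> v" "a \<notin> T" "b \<in> V" "b \<noteq> v" "b \<notin> T" "E a b" by (auto simp: arcs_def)
    have x: "w \<notin> M" if "E x w" for w using that by (auto simp: T_eq)
    consider "a \<in> M" "b \<in> M" | "a \<in> R" "b \<in> R" | "a \<in> R" "b \<in> M" | "a \<in> M" "b \<in> R" using ab by auto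
    then show "(a, b) \<in> arcs M M \<union> (F \<union> prod.swap ` F)"
    proof cases
      case 1 then show ?thesis using ab by (auto simp: arcs_def)
    next
      case 2 then show ?thesis using R_indep ab by blast
    next
      case 3
      then have "(a, b) \<in> F" using ab x by (auto simp: F_def)
      then show ?thesis by blast
    next
      case 4
      then have "(b, a) \<in> F" using sym[OF ab(7)] x by (auto simp: F_def)
      then have "prod.swap (b, a) \<in> prod.swap ` F" by (rule imageI)
      then show ?thesis by simp
    qed
  qed
  then have "inner (V - insert v T) \<le> card (arcs M M \<union> (F \<union> prod.swap ` F))"
    unfolding inner_def using finF finite_arcs by (intro card_mono) simp_all
  also have "\<dots> \<le> inner M + card (F \<union> prod.swap ` F)" unfolding inner_def by (rule card_Un_le)
  also have "card (F \<union> prod.swap ` F) \<le> card F + card (prod.swap ` F)" by (rule card_Un_le)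
  also have "card (prod.swap ` F) = card F" by (simp add: card_image)
  finally show ?thesis using cF by simp
qed

lemma inner_X: "2 * (of_bool (u \<in> T) + of_bool (z \<in> T)) \<le> inner (insert v T)"
proof -
  let ?S = "arcs (insert v T) (insert v T)"
  have vuz: "v \<noteq> u" "v \<noteq> z" using vu vz irr by auto
  define U where "U = (if u \<in> T then {(v, u), (u, v)} else {})"
  define Z where "Z = (if z \<in> T then {(v, z), (z, v)} else {})"
  have "card (U \<union> Z) = card U + card Z"
    using zu vuz by (intro card_Un_disjoint) (auto simp: U_def Z_def)
  moreover have "card U = 2 * of_bool (u \<in> T)" "card Z = 2 * of_bool (z \<in> T)"
    using vuz by (auto simp: U_def Z_def)
  moreover have "card (U \<union> Z) \<le> card ?S"
    using vu vz sym by (intro card_mono finite_arcs) (auto simp: U_def Z_def arcs_def split: if_splits)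
  ultimately show ?thesis by (simp add: inner_def)
qed

lemma T_V: "insert v T \<subseteq> V" using T_sub subQ inV vz by auto

lemma card_X: "card (insert v T) = k"
  using card_T finT T_sub v_notin_Q by (subst card_insert_disjoint) auto

lemma card_W: "card (V - insert v T) + k = card V"
  using card_X T_V finV card_mono[OF finV T_V] by (simp add: card_Diff_subset finT)

text \<open>\<open>insert v T\<close> is \<open>N x\<close>, of size \<open>k\<close>, so the two
  values of \<open>inner\<close> differ by \<open>k * (card V - 2 * k)\<close>.\<close>

lemma balance: "inner (insert v T) + k * card (V - insert v T) = inner (V - insert v T) + k * k"
  using inner_balance[OF T_V] card_X by simp

text \<open>Both path neighbours of \<open>q\<close> lie in \<open>M\<close>, since \<open>q\<close>
  is next to no attachment; lying beside \<open>q\<close>, which is in \<open>M\<close> too, they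
  fall into \<open>L\<close> and \<open>P\<close>.\<close>

lemma neither_interior:
  assumes "q \<in> P" "q \<in> L" "q \<noteq> z" "q \<noteq> u"
  obtains i where "Suc (Suc i) < length Q" "q = Q ! Suc i" "Q ! i \<in> L" "Q ! Suc (Suc i) \<in> P"
proof -
  have q: "q \<in> M" "q \<notin> succs Q T" "q \<notin> preds Q T" using assms by (auto simp: P_def L_def)
  then obtain j where j: "j < length Q" "q = Q ! j" by (auto simp: in_set_conv_nth)
  have "j \<noteq> 0" using j assms(3) hdQ neQ hd_conv_nth by metis
  then obtain i where i: "j = Suc i" by (cases j) auto
  have lt: "Suc (Suc i) < length Q"
  proof (rule ccontr)
    assume "\<not> ?thesis"
    then have "j = length Q - 1" using j i by simp
    then show False using j assms(4) lastQ neQ by (simp add: last_conv_nth)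
  qed
  have "Q ! i \<notin> T" using q(2) i j lt by (auto simp: succs_def)
  moreover have "Q ! Suc (Suc i) \<notin> T" using q(3) i j lt by (auto simp: preds_def)
  moreover have "Q ! i \<notin> preds Q T"
    using q(1) i j lt by (auto simp: preds_def nth_Q_eq_iff)
  moreover have "Q ! Suc (Suc i) \<notin> succs Q T"
    using q(1) i j lt by (auto simp: succs_def nth_Q_eq_iff)
  ultimately show thesis using that[of i] lt i j by (auto simp: P_def L_def)
qed

lemma two_if_neither:
  assumes "q \<in> P" "q \<in> L" "q \<noteq> z" "q \<noteq> u"
  shows "card P \<ge> 2" "card L \<ge> 2"
proof -
  obtain i where i: "Suc (Suc i) < length Q" "q = Q ! Suc i" "Q ! i \<in> L" "Q ! Suc (Suc i) \<in> P"
    using neither_interior[OF assms] .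
  have "Q ! i \<noteq> q" "Q ! Suc (Suc i) \<noteq> q" using i distQ by (simp_all add: nth_eq_iff_index_eq)
  then have "card {q, Q ! Suc (Suc i)} = 2" "card {q, Q ! i} = 2" by auto
  moreover have "card {q, Q ! Suc (Suc i)} \<le> card P" "card {q, Q ! i} \<le> card L"
    using assms i fin_PL by (auto intro!: card_mono)
  ultimately show "card P \<ge> 2" "card L \<ge> 2" by simp_all
qed

section \<open>The possible lengths of the path\<close>

lemma card_V_ge: "2 * k \<le> card V + 1" using card_D by simp

text \<open>By \<open>card_P\<close> the path has \<open>2k - 3\<close>, \<open>2k - 2\<close> or \<open>2k - 1\<close> vertices.\<close>

lemma tight_path: assumes "length Q + 3 = 2 * k" shows False
proof -
  \<comment> \<open>Here \<open>card P\<close> is \<open>of_bool (u \<in> T) - 1\<close>, which must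
    not be negative; likewise for \<open>L\<close> and \<open>z\<close>.\<close>
  have uz: "u \<in> T" "z \<in> T" using card_P card_L assms by (auto simp: of_bool_def split: if_splits)
  then have "card P = 0" "card L = 0" using card_P card_L assms by simp_all
  then have PL: "P = {}" "L = {}" using fin_PL by simp_all
  have iM: "inner M = 0" using inner_M PL by simp
  have W: "inner (V - insert v T) \<le> 2 * (card R - 1)"
    using inner_outside[of 1] nbrs_in_M_P PL iM by simp
  have X: "4 \<le> inner (insert v T)" using inner_X uz by simp
  consider "card V = 2 * k + 1" "card R = 3" | "card V = 2 * k" "card R = 2" | "card V + 1 = 2 * k" "card R = 1"
    using card_R assms small card_V_ge by linarith
  then show False
  proof cases
    case 1
    then have "card (V - insert v T) = k + 1" using card_W by simp
    then show False using balance W X 1 k_ge_3 by simp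
  next
    case 2
    then have "card (V - insert v T) = k" using card_W by simp
    then show False using balance W X 2 by simp
  next
    case 3
    then have "inner (V - insert v T) = 0" using W by simp
    then have "arcs (V - insert v T) (V - insert v T) = {}" using finite_arcs by (simp add: inner_def)
    then have no: "\<not> E a b" if "a \<in> V - insert v T" "b \<in> V - insert v T" for a b
      using that by (auto simp: arcs_def)
    \<comment> \<open>Each vertex \<open>w\<close> of the independent outside must have
      \<open>N w = insert v T\<close>. Then \<open>v\<close> has these \<open>k - 1\<close>
      neighbours as well as \<open>u\<close> and \<open>z\<close>.\<close>
    have "V - insert v T \<subseteq> N v"
    proof
      fix w assume w: "w \<in> V - insert v T"
      then have "N w \<subseteq> insert v T" using no inV by blast
      moreover have "card (N w) = card (insert v T)" using cardN w card_X by simp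
      ultimately have "N w = insert v T" using finT by (intro card_subset_eq) auto
      then show "w \<in> N v" using sym by blast
    qed
    then have "card ((V - insert v T) \<union> {u, z}) \<le> k"
      using card_mono[OF finN, of "(V - insert v T) \<union> {u, z}" v] cardN[OF vV] vu vz by auto
    moreover have "card ((V - insert v T) \<union> {u, z}) = card (V - insert v T) + card {u, z}"
      using finV uz by (intro card_Un_disjoint) auto
    ultimately show False using card_W 3 zu by simp
  qed
qed

text \<open>The indicators of \<open>u\<close> and \<open>z\<close> in \<open>T\<close> bound the
  pairs outside \<open>N x\<close> from above, through \<open>P\<close> and \<open>L\<close>, and
  those inside from below, through the edges at \<open>v\<close>; the bounds contradict
  \<open>balance\<close>.\<close>

lemma near_tight_path: assumes "length Q + 2 = 2 * k" shows False
proof -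
  have cP: "card P = of_bool (u \<in> T)" and cL: "card L = of_bool (z \<in> T)"
    using card_P card_L assms by auto
  have disj: "P \<inter> L = {}"
  proof (rule ccontr)
    assume "\<not> ?thesis"
    then obtain q where q: "q \<in> P" "q \<in> L" by blast
    then have "card P > 0" "card L > 0" using fin_PL by (auto simp: card_gt_0_iff)
    then have "u \<in> T" "z \<in> T" using cP cL by (auto simp: of_bool_def split: if_splits)
    then have "q \<noteq> z" "q \<noteq> u" using q by (auto simp: P_def)
    then show False using two_if_neither[OF q] cP by (simp add: of_bool_def split: if_splits)
  qed
  have one: "u \<in> T \<or> z \<in> T"
    using z_P cP fin_PL by (metis card_gt_0_iff empty_iff less_numeral_extra(3) of_bool_eq(1))
  \<comment> \<open>If just one of \<open>u\<close>, \<open>z\<close> lies in \<open>T\<close>, the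
    indicator of the other gives the sharper bound.\<close>
  have W: "inner (V - insert v T) \<le> 2 * (of_bool (u \<in> T) * of_bool (z \<in> T)) + 2 * ((card R - 1) * B)"
    if "B = 1 + of_bool (u \<in> T) \<or> B = 1 + of_bool (z \<in> T)" for B
  proof -
    have "inner (V - insert v T) \<le> inner M + 2 * ((card R - 1) * B)"
      using that nbrs_in_M_P nbrs_in_M_L cP cL by (intro inner_outside) auto
    then show ?thesis using inner_M[OF disj, unfolded cP cL] by linarith
  qed
  note W1 = W[of "1 + of_bool (u \<in> T)", simplified] and W2 = W[of "1 + of_bool (z \<in> T)", simplified]
  have Rpos: "card R > 0" using xR finV by (auto simp: card_gt_0_iff)
  consider "card V = 2 * k + 1" "card R = 2" | "card V = 2 * k" "card R = 1"
    using card_R assms small card_V_ge Rpos by linarith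
  then show False
  proof cases
    case 1
    then have "card (V - insert v T) = k + 1" using card_W by simp
    then have "inner (insert v T) + k = inner (V - insert v T)" using balance by simp
    then show False using W1 W2 inner_X one k_ge_3 1 by (cases "u \<in> T"; cases "z \<in> T") simp_all
  next
    case 2
    then have "card (V - insert v T) = k" using card_W by simp
    then have "inner (insert v T) = inner (V - insert v T)" using balance by simp
    then show False using W1 inner_X one 2 by (cases "u \<in> T"; cases "z \<in> T") simp_all
  qed
qed

text \<open>The new path goes from \<open>A\<close> through \<open>x\<close> into \<open>B\<close>
  backwards, then over \<open>q\<close> and \<open>b\<close> to \<open>C\<close>, using the chord
  from \<open>b\<close> to \<open>hd C\<close>.\<close>

lemma bridge_left:
  assumes "Q = A @ B @ [b, q] @ C" "A \<noteq> []" "B \<noteq> []" "C \<noteq> []"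
    "E x (last A)" "E x (last B)" "E b (hd C)" "E (hd B) q"
  shows False
proof -
  have "length (A @ [x] @ rev B @ [q, b] @ C) \<le> length Q"
    by (intro maxQ) (use assms distQ succQ subQ hdQ lastQ xR sym[OF assms(5)] in
      \<open>auto simp: successively_append_iff successively_Cons hd_rev last_rev dest: sym\<close>)
  then show False using assms by simp
qed

lemma bridge_right:
  assumes "Q = A @ [q, d] @ B @ C" "A \<noteq> []" "B \<noteq> []" "C \<noteq> []"
    "E x (hd B)" "E x (hd C)" "E (last A) d" "E q (last B)"
  shows False
proof -
  have "length (A @ [d, q] @ rev B @ [x] @ C) \<le> length Q"
    by (intro maxQ) (use assms distQ succQ subQ hdQ lastQ xR sym[OF assms(5)] in
      \<open>auto simp: successively_append_iff successively_Cons hd_rev last_rev dest: sym\<close>)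
  then show False using assms by simp
qed

lemma nth_T_adj: "Q ! i \<in> T \<Longrightarrow> E x (Q ! i)" by (simp add: T_eq)

text \<open>If a vertex of \<open>Q\<close> is bypassed by an edge between its two neighbours on \<open>Q\<close>, it can be visited next to
  \<open>w\<close> instead, and \<open>x\<close> closes the gap that this opens.\<close>

lemma neither_nonadjacent:
  assumes i: "Suc (Suc i) < length Q" and bd: "E (Q ! i) (Q ! Suc (Suc i))"
    and T2: "Q ! i \<in> succs Q T" "Q ! Suc (Suc i) \<in> preds Q T"
    and w: "w \<in> succs Q T" "w \<in> preds Q T" "w \<noteq> Q ! i" "w \<noteq> Q ! Suc (Suc i)" "w \<noteq> Q ! Suc i"
  shows "\<not> E (Q ! Suc i) w"
proof
  assume adj: "E (Q ! Suc i) w"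
  obtain e where e: "w = Q ! Suc e" "Suc e < length Q" "Q ! e \<in> T" using w(1) by (auto simp: succs_def)
  obtain e' where e': "w = Q ! e'" "Suc e' < length Q" "Q ! Suc e' \<in> T" using w(2) by (auto simp: preds_def)
  have "e' = Suc e" using e e' nth_Q_eq_iff by auto
  then have e2: "Suc (Suc e) < length Q" "Q ! Suc (Suc e) \<in> T" using e' by auto
  obtain c where c: "Q ! i = Q ! Suc c" "Suc c < length Q" "Q ! c \<in> T" using T2(1) by (auto simp: succs_def)
  then have ic: "i = Suc c" using nth_Q_eq_iff i by auto
  obtain d where "Q ! Suc (Suc i) = Q ! d" "Suc d < length Q" "Q ! Suc d \<in> T" using T2(2) by (auto simp: preds_def)
  then have d: "Suc (Suc (Suc i)) < length Q" "Q ! Suc (Suc (Suc i)) \<in> T" using nth_Q_eq_iff i by auto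
  have "Suc e \<noteq> i" "Suc e \<noteq> Suc (Suc i)" "Suc e \<noteq> Suc i" using w(3-5) e(1) by auto
  then consider "e < c" | "Suc (Suc i) < Suc e" using ic by linarith
  then show False
  proof cases
    case 1
    show False
    proof (rule bridge_left)
      have "seg Q (Suc c) (Suc (Suc (Suc c))) = [Q ! Suc c, Q ! Suc (Suc c)]"
        using i ic by (intro seg_two) simp
      then show "Q = seg Q 0 (Suc e) @ seg Q (Suc e) (Suc c) @ [Q ! Suc c, Q ! Suc (Suc c)] @ seg Q (Suc (Suc (Suc c))) (length Q)"
        using Q_split4[of "Suc e" "Suc c" "Suc (Suc (Suc c))"] i ic 1 by simp
    qed (use 1 i ic e c bd adj sym nth_T_adj in \<open>auto simp: seg_simps\<close>)
  next
    case 2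
    then have "Suc (Suc (Suc i)) < Suc (Suc e)" by simp
    show False
    proof (rule bridge_right)
      have "seg Q (Suc i) (Suc (Suc (Suc i))) = [Q ! Suc i, Q ! Suc (Suc i)]"
        using i by (intro seg_two) simp
      then show "Q = seg Q 0 (Suc i) @ [Q ! Suc i, Q ! Suc (Suc i)] @ seg Q (Suc (Suc (Suc i))) (Suc (Suc e)) @ seg Q (Suc (Suc e)) (length Q)"
        using Q_split4[of "Suc i" "Suc (Suc (Suc i))" "Suc (Suc e)"] i 2 e2 by simp
    qed (use 2 i e e2 d bd adj nth_T_adj in \<open>auto simp: seg_simps\<close>)
  qed
qed

lemma roomy_card_M: "length Q + 1 = 2 * k \<Longrightarrow> card M = k"
  using card_T T_sub finT distinct_card[OF distQ] by (simp add: card_Diff_subset)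

text \<open>\<open>M\<close> has \<open>k\<close> elements here, none adjacent to \<open>x\<close>,
  so exchanging \<open>q\<close> for \<open>x\<close> gives an independent set of the right
  size.\<close>

lemma class_H_M:
  assumes "length Q + 1 = 2 * k" "q \<in> M" "u \<notin> M - {q}" "z \<notin> M - {q}"
    "\<And>a b. a \<in> M - {q} \<Longrightarrow> b \<in> M - {q} \<Longrightarrow> \<not> E a b"
  shows False
proof (rule class_H_contra)
  have "card R > 0" using xR finV by (auto simp: card_gt_0_iff)
  then show "card V = 2 * k + 1" using assms(1) card_R small by simp
  have "x \<notin> M" using xR by auto
  then show "card (insert x (M - {q})) = k" using roomy_card_M[OF assms(1)] assms(2) k_ge_3 by simp
  show "insert x (M - {q}) \<subseteq> V - {u, v, z}" using assms(3,4) xR uz_Q subQ by auto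
  have "\<not> E x a" "\<not> E a x" if "a \<in> M" for a using that sym by (auto simp: T_eq)
  then show "\<not> E a b" if "a \<in> insert x (M - {q})" "b \<in> insert x (M - {q})" for a b
    using that assms(5) irr by auto
qed

text \<open>Otherwise \<open>L = {z}\<close>, so \<open>M - {z}\<close> consists of predecessors of
  attachments and is independent.\<close>

lemma roomy_z:
  assumes "length Q + 1 = 2 * k" shows "z \<notin> P \<inter> L"
proof
  assume z: "z \<in> P \<inter> L"
  then have "z \<notin> T" by (auto simp: P_def)
  then have "card L = 1" using card_L assms by simp
  then have L: "L = {z}" using z by (auto simp: card_1_singleton_iff)
  have "u \<notin> M" using u_L L zu by auto
  then show False
    using assms z L preds_indep
    by (intro class_H_M[of z]) (auto simp: L_def)
qed

text \<open>The order 0, \<open>x\<close>, 3, 4, 2, 1, 5, 6 of positions gives a path longer by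
  one.\<close>

lemma degree_four_path:
  assumes m: "length Q = 7" and T: "Q ! 0 \<in> T" "Q ! 3 \<in> T" and E2: "E (Q ! 4) (Q ! 2)" "E (Q ! 1) (Q ! 5)"
  shows False
proof -
  obtain a0 a1 a2 a3 a4 a5 a6 where Q: "Q = [a0, a1, a2, a3, a4, a5, a6]"
    using m by (auto simp: eval_nat_numeral length_Suc_conv)
  have "length [a0, x, a3, a4, a2, a1, a5, a6] \<le> length Q"
  proof (rule maxQ)
    have "E x a0" "E x a3" using T nth_T_adj[of 0] nth_T_adj[of 3] by (simp_all add: Q)
    moreover have "E a3 a4" "E a1 a2" "E a5 a6" using succQ by (simp_all add: Q)
    moreover have "E a4 a2" "E a1 a5" using E2 by (simp_all add: Q)
    ultimately show "successively E [a0, x, a3, a4, a2, a1, a5, a6]" using sym by simp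
    show "distinct [a0, x, a3, a4, a2, a1, a5, a6]" using distQ xR by (auto simp: Q)
  qed (use subQ xR hdQ lastQ in \<open>auto simp: Q\<close>)
  then show False using m by simp
qed

end

context isolated_vertex begin

interpretation rv: isolated_vertex V E k v u z "rev Q" x
  by (rule isolated_reversed)

lemma roomy_u: "length Q + 1 = 2 * k \<Longrightarrow> u \<notin> P \<inter> L"
  using rv.roomy_z by (auto simp: rv_P rv_L)

text \<open>The path neighbours \<open>?b\<close> and \<open>?d\<close> of a common vertex
  \<open>q\<close> fill up \<open>L\<close> and \<open>P\<close>. If they are not adjacent,
  \<open>M - {q}\<close> is independent; otherwise \<open>M\<close> spans at most the three edges
  among \<open>?b\<close>, \<open>q\<close>, \<open>?d\<close>, too few for the balance.\<close>

lemma roomy_disjoint: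
  assumes m: "length Q + 1 = 2 * k" and inn: "inner (insert v T) + k = inner M"
  shows "P \<inter> L = {}"
proof (rule ccontr)
  assume "\<not> ?thesis"
  then obtain q where q: "q \<in> P" "q \<in> L" by blast
  then have qn: "q \<noteq> z" "q \<noteq> u" using roomy_z roomy_u m by auto
  obtain i where i: "Suc (Suc i) < length Q" "q = Q ! Suc i" "Q ! i \<in> L" "Q ! Suc (Suc i) \<in> P"
    using neither_interior[OF q qn] .
  let ?b = "Q ! i" and ?d = "Q ! Suc (Suc i)"
  have ne: "?b \<noteq> q" "?d \<noteq> q" "?b \<noteq> ?d" using i distQ by (simp_all add: nth_eq_iff_index_eq)
  have uz: "u \<in> T" "z \<in> T" "card P = 2" "card L = 2"
    using two_if_neither[OF q qn] card_P card_L m by (auto simp: of_bool_def split: if_splits)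
  have P: "{q, ?d} = P" using q i ne fin_PL uz by (intro card_subset_eq) auto
  have L: "{q, ?b} = L" using q i ne fin_PL uz by (intro card_subset_eq) auto
  have qM: "q \<in> M" using q by (auto simp: P_def)
  have bd: "E ?b ?d"
  proof (rule ccontr)
    assume no: "\<not> E ?b ?d"
    show False
    proof (rule class_H_M[OF m qM])
      show "\<not> E a b" if "a \<in> M - {q}" "b \<in> M - {q}" for a b
      proof
        assume "E a b"
        then have "(a \<in> P \<or> b \<in> P) \<and> (a \<in> L \<or> b \<in> L)" using edge_in_M that by blast
        then have "(a = ?d \<or> b = ?d) \<and> (a = ?b \<or> b = ?b)" using P L that by auto
        then show False using no \<open>E a b\<close> ne sym by metis
      qed
    qed (use uz in auto)
  qed
  have "?b \<notin> P" "?d \<notin> L" unfolding P[symmetric] L[symmetric] using ne by simp_all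
  then have b': "?b \<in> succs Q T" and d': "?d \<in> preds Q T"
    using i(3,4) by (simp_all add: P_def L_def)
  have qq: "\<not> E q w" if "w \<in> M" "w \<noteq> ?b" "w \<noteq> ?d" for w
  proof (cases "w = q")
    case False
    then have "w \<notin> P" "w \<notin> L" using P L that by auto
    then have "w \<in> succs Q T" "w \<in> preds Q T" using that by (auto simp: P_def L_def)
    then show ?thesis using neither_nonadjacent[OF i(1) bd b' d'] that i(2) False by simp
  qed (use irr in simp)
  have "arcs M M \<subseteq> {(?b, ?d), (?d, ?b), (q, ?b), (?b, q), (q, ?d), (?d, q)}"
  proof (rule subrelI)
    fix a b assume "(a, b) \<in> arcs M M"
    then have ab: "a \<in> M" "b \<in> M" "E a b" by (auto simp: arcs_def)
    then have ed: "(a \<in> P \<or> b \<in> P) \<and> (a \<in> L \<or> b \<in> L)" using edge_in_M by blast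
    consider "a = q" | "b = q" | "a \<noteq> q" "b \<noteq> q" by blast
    then show "(a, b) \<in> {(?b, ?d), (?d, ?b), (q, ?b), (?b, q), (q, ?d), (?d, q)}"
    proof cases
      case 1 then show ?thesis using qq[of b] ab by blast
    next
      case 2 then show ?thesis using qq[of a] ab sym by blast
    next
      case 3
      then have "(a = ?d \<or> b = ?d) \<and> (a = ?b \<or> b = ?b)" using ed P L by auto
      then show ?thesis using ne by auto
    qed
  qed
  then have "inner M \<le> card {(?b, ?d), (?d, ?b), (q, ?b), (?b, q), (q, ?d), (?d, q)}"
    unfolding inner_def by (intro card_mono) auto
  also have "\<dots> \<le> 6" by (rule order_trans[OF card_length[of "[_, _, _, _, _, _]", simplified]]) simp
  finally show False using inn inner_X uz k_ge_3 by simp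
qed

lemma roomy_path:
  assumes m: "length Q + 1 = 2 * k" shows False
proof -
  have R1: "card R > 0" using xR finV by (auto simp: card_gt_0_iff)
  then have n: "card V = 2 * k + 1" and R: "card R = 1" using card_R m small by simp_all
  have "card (V - insert v T) = k + 1" using card_W n by simp
  then have "inner (insert v T) + k = inner (V - insert v T)" using balance by simp
  moreover have "inner (V - insert v T) \<le> inner M"
    using inner_outside[of "1 + card P"] nbrs_in_M_P R by simp
  moreover have "inner M \<le> inner (V - insert v T)"
    unfolding inner_def using subQ by (intro card_mono finite_arcs) (auto simp: arcs_def)
  ultimately have inn: "inner (insert v T) + k = inner M" by simp
  have disj: "P \<inter> L = {}" using roomy_disjoint[OF m inn] .
  have cP: "card P = 1 + of_bool (u \<in> T)" and cL: "card L = 1 + of_bool (z \<in> T)"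
    using card_P card_L m by auto
  \<comment> \<open>With indicators \<open>s\<close>, \<open>t\<close> of \<open>u\<close>,
    \<open>z\<close> in \<open>T\<close>, the counts give
    \<open>k + 2 * (s + t) <= 2 * (1 + s) * (1 + t)\<close>, and \<open>k >= 3\<close> forces
    \<open>s = t = 1\<close>.\<close>
  have uz: "u \<in> T" "z \<in> T" "k \<le> 4"
    using inner_M[OF disj] inn inner_X cP cL k_ge_3 by (auto simp: of_bool_def split: if_splits)
  have c2: "card P = 2" "card L = 2" using cP cL uz by auto
  \<comment> \<open>A missing edge would lower the bound on \<open>inner M\<close> from eight to
    six, below the required \<open>k + 4\<close>.\<close>
  have all: "E p l" if "p \<in> P" "l \<in> L" for p l
  proof (rule ccontr)
    assume no: "\<not> E p l"
    have pl: "p \<noteq> l" using that disj by auto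
    have "arcs M M \<subseteq> (P \<times> L - {(p, l)}) \<union> (L \<times> P - {(l, p)})"
      using edge_in_M disj no sym by (auto simp: arcs_def)
    then have "inner M \<le> card ((P \<times> L - {(p, l)}) \<union> (L \<times> P - {(l, p)}))"
      unfolding inner_def using fin_PL by (intro card_mono) auto
    also have "\<dots> \<le> card (P \<times> L - {(p, l)}) + card (L \<times> P - {(l, p)})" by (rule card_Un_le)
    also have "\<dots> = 6" using that fin_PL c2 by (simp add: card_cartesian_product)
    finally show False using inn inner_X uz k_ge_3 by simp
  qed
  have ends: "Q ! 0 \<in> T" "Q ! (length Q - 1) \<in> T"
    using uz hdQ lastQ neQ by (auto simp: hd_conv_nth last_conv_nth)
  have inP: "Q ! Suc j \<in> P" if "Suc j < length Q" "Q ! j \<notin> T" "Q ! Suc j \<notin> T" for j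
    using that nth_Q_eq_iff by (auto simp: P_def succs_def)
  have inL: "Q ! j \<in> L" if "Suc j < length Q" "Q ! Suc j \<notin> T" "Q ! j \<notin> T" for j
    using that nth_Q_eq_iff by (auto simp: L_def preds_def)
  \<comment> \<open>The middle one of three consecutive vertices off \<open>T\<close> would lie in
    both \<open>P\<close> and \<open>L\<close>.\<close>
  have three: "\<not> (Q ! j \<notin> T \<and> Q ! Suc j \<notin> T \<and> Q ! Suc (Suc j) \<notin> T)" if "Suc (Suc j) < length Q" for j
    using inP[of j] inL[of "Suc j"] that disj by auto
  have "k = 3 \<or> k = 4" using uz k_ge_3 by auto
  then show False
  proof
    assume "k = 3"
    then have l: "length Q = 5" using m by simp
    have "Q ! 1 \<notin> T" using no_consec[of 0] l ends by simp
    moreover have "Q ! 3 \<notin> T" using no_consec[of 3] l ends by auto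
    moreover have "Q ! 2 \<notin> T"
    proof
      assume "Q ! 2 \<in> T"
      then have "{Q ! 0, Q ! 2, Q ! 4} \<subseteq> T" using ends l by auto
      then have "card {Q ! 0, Q ! 2, Q ! 4} \<le> card T" using finT by (rule card_mono[rotated])
      then show False using card_T \<open>k = 3\<close> l by (simp add: nth_Q_eq_iff)
    qed
    ultimately show False using three[of 1] l by (simp add: eval_nat_numeral)
  next
    assume k4: "k = 4"
    then have l: "length Q = 7" using m by simp
    have T4: "\<not> {Q ! 0, Q ! a, Q ! b, Q ! 6} \<subseteq> T" if "0 < a" "a < b" "b < 6" for a b
    proof
      assume "{Q ! 0, Q ! a, Q ! b, Q ! 6} \<subseteq> T"
      then have "card {Q ! 0, Q ! a, Q ! b, Q ! 6} \<le> card T" using finT by (rule card_mono[rotated])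
      then show False using card_T k4 l that by (simp add: nth_Q_eq_iff)
    qed
    have e6: "Q ! 6 \<in> T" using ends l by simp
    have n1: "Q ! 1 \<notin> T" using no_consec[of 0] l ends by simp
    have n5: "Q ! 5 \<notin> T" using no_consec[of 5] l e6 by auto
    have t1: "Q ! 2 \<in> T \<or> Q ! 3 \<in> T" using three[of 1] n1 l by (simp add: eval_nat_numeral)
    have t2: "Q ! 3 \<in> T \<or> Q ! 4 \<in> T" using three[of 3] n5 l by (simp add: eval_nat_numeral)
    \<comment> \<open>\<open>T\<close> has three elements, two of them the ends of \<open>Q\<close>;
      position 3 is the only place for the third.\<close>
    have "Q ! 3 \<in> T" using t1 t2 T4[of 2 4] ends e6 by auto
    moreover from this have n24: "Q ! 2 \<notin> T" "Q ! 4 \<notin> T" using T4[of 2 3] T4[of 3 4] ends e6 by auto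
    moreover have "Q ! 2 \<in> P" "Q ! 5 \<in> P" "Q ! 1 \<in> L" "Q ! 4 \<in> L"
      using inP[of 1] inP[of 4] inL[of 1] inL[of 4] n1 n5 n24 l by (simp_all add: eval_nat_numeral)
    then have "E (Q ! 4) (Q ! 2)" "E (Q ! 1) (Q ! 5)" using all sym by blast+
    ultimately show False using degree_four_path[OF l ends(1)] by blast
  qed
qed

lemma contradiction: False
proof -
  have "card R > 0" using xR finV by (auto simp: card_gt_0_iff)
  then have "length Q + 2 \<le> card V" using card_R by simp
  moreover have "2 * k \<le> length Q + 3" using card_P by (auto simp: of_bool_def split: if_splits)
  ultimately consider "length Q + 3 = 2 * k" | "length Q + 2 = 2 * k" | "length Q + 1 = 2 * k"
    using small by linarith
  then show False using tight_path near_tight_path roomy_path by cases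
qed

end

section \<open>The Hamiltonian cycle\<close>

lemma (in longest_path) spanning:
  assumes "\<not> in_class_H V E k u v z"
  shows "set Q = V - {v}"
proof (rule ccontr)
  assume "set Q \<noteq> V - {v}"
  then obtain x where "x \<in> R" using subQ by blast
  then interpret isolated_vertex V E k v z u Q x
    using all_singletons assms unfolding isolated_vertex_def isolated_vertex_axioms_def by blast
  show False by (rule contradiction)
qed

lemma ham_cycle_from_path:
  assumes "distinct Q" "successively E Q" "set Q = V - {v}" "Q \<noteq> []" "hd Q = z" "last Q = u"
    "E v z" "E u v" "v \<in> V" "z \<noteq> u"
  shows "ham_cycle V E (v # Q)" "cycle_has_edge (v # Q) u v" "cycle_has_edge (v # Q) v z"
proof -
  have len: "length Q \<ge> 2"
    using assms by (cases Q rule: list.exhaust; cases "tl Q") auto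
  have 0: "(v # Q) ! Suc 0 = z" "(v # Q) ! length Q = u"
    using assms by (auto simp: hd_conv_nth last_conv_nth nth_Cons')
  have step: "E ((v # Q) ! i) ((v # Q) ! ((i + 1) mod length (v # Q)))" if i: "i < length (v # Q)" for i
  proof (cases "i = length Q")
    \<comment> \<open>The index wraps round to \<open>v\<close>, giving the closing edge from
      \<open>u\<close>.\<close>
    case True then show ?thesis using 0 assms by simp
  next
    case False
    then have "Suc i < length (v # Q)" using i by simp
    moreover have "successively E (v # Q)" using assms by (simp add: successively_Cons)
    ultimately show ?thesis by (simp add: successively_conv_nth)
  qed
  show "ham_cycle V E (v # Q)"
    unfolding ham_cycle_def using assms len step by auto
  show "cycle_has_edge (v # Q) u v"
    unfolding cycle_has_edge_def using 0 by (intro exI[of _ "length Q"]) simp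
  show "cycle_has_edge (v # Q) v z"
    unfolding cycle_has_edge_def using 0 assms(4) by (intro exI[of _ 0]) simp
qed

theorem theorem3:
  fixes V :: "'a set" and E :: "'a \<Rightarrow> 'a \<Rightarrow> bool" and k n :: nat and u v z :: 'a
  assumes "sgraph V E"
    and "k > 0"
    and "two_connected V E"
    and "regular V E k"
    and "card V = n"
    and "u \<in> V" and "v \<in> V" and "z \<in> V"
    and "u \<noteq> v" and "v \<noteq> z" and "u \<noteq> z"
    and "E u v" and "E v z"
    and "connected_on E (V - {u, v, z})"
    and "\<not> in_class_H V E k u v z"
    and "n \<le> 2 * k + 1"
  shows "\<exists>cs. ham_cycle V E cs \<and> cycle_has_edge cs u v \<and> cycle_has_edge cs v z"
proof -
  interpret graph V E k by unfold_locales (use assms in auto)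
  define good where "good P \<longleftrightarrow> distinct P \<and> successively E P \<and> set P \<subseteq> V - {v} \<and> P \<noteq> []
    \<and> hd P = z \<and> last P = u" for P
  have "connected_on E (V - {v})" using assms by (auto simp: two_connected_def)
  then have "(\<lambda>a b. a \<in> V - {v} \<and> b \<in> V - {v} \<and> E a b)\<^sup>*\<^sup>* z u"
    using assms unfolding connected_on_def by blast
  then obtain P0 where P0: "good P0"
    using rtranclp_imp_path[of "V - {v}" E z u] assms unfolding good_def by blast
  have bound: "\<forall>P. good P \<longrightarrow> length P < Suc (card V)"
  proof (intro allI impI)
    fix P assume "good P"
    then have "card (set P) \<le> card V" "distinct P" using finV by (auto simp: good_def intro: card_mono)
    then show "length P < Suc (card V)" by (simp add: distinct_card)
  qed
  obtain Q where Q: "good Q" and max: "\<forall>P. good P \<longrightarrow> length P \<le> length Q"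
    using ex_has_greatest_nat[OF P0 bound] by blast
  interpret longest_path V E k v z u Q
    by unfold_locales (use assms Q max sym[OF \<open>E u v\<close>] in \<open>auto simp: good_def\<close>)
  have "set Q = V - {v}" using spanning assms by blast
  then show ?thesis
    using ham_cycle_from_path[of Q E V v z u] Q assms unfolding good_def by blast
qed

end
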